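(* Let $S=K[x_1,\dots,x_n,z]$, let $I=(f_1,\dots,f_n)\subset S$ be such that $(f_1,\dots,f_n,g)$ is a generic ideal of type $(n+1,d_1,\dots,d_n,d)$ in $S$, with generic generators $f_1,\dots,f_n,g$. Let $\delta=d_1+\cdots+d_n-n$, and let $B_k$ be the set of monomials of degree $k$ in $K[x_1,\dots,x_n]$ that are not in $\operatorname{in}(I)$. If $d\ge\delta$, then $$\operatorname{in}(I,g)=\big(\operatorname{in}(I),\ z^{d-\delta}B_\delta,\ z^{d-\delta+2}B_{\delta-1},\ \dots,\ z^{\delta+d-2}B_1,\ z^{\delta+d}B_0\big),$$ that is, $\operatorname{in}(I,g)$ is generated by $\operatorname{in}(I)$ together with the monomials in $z^{d-\delta+2i}B_{\delta-i}$ for $0\le i\le\delta$.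
   Context: $K$ is an infinite field that is an extension of a base field $F$. The monomial order on $S$ is the graded reverse lexicographic order with $x_1>\cdots>x_n>z$. A generic ideal of type $(n+1,d_1,\dots,d_n,d)$ is an ideal of $S$ generated by homogeneous polynomials $f_1,\dots,f_n,g$ of degrees $d_1,\dots,d_n,d\ge1$, each a linear combination of all monomials of $S$ of its degree, with all the coefficients (of all the generators together) algebraically independent over $F$. $(I,g)$ denotes the ideal $(f_1,\dots,f_n,g)$. (The sets $B_k$ coincide with the sets of standard monomials of degree $k$ of the image $J\subset K[x_1,\dots,x_n]$ of $I$ under $z\mapsto0$; $B_k=\emptyset$ for $k>\delta$.) For a monomial $m$ and a set $T$ of monomials, $mT=\{mt : t\in T\}$. *)

theory Defs
  imports "HOL-Library.Poly_Mapping" "HOL.Hull"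
begin

text \<open>
  Monomials are exponent vectors \<^typ>\<open>nat \<Rightarrow>\<^sub>0 nat\<close>, polynomials are finitely supported
  coefficient functions on them, with the convolution product of \<^theory>\<open>HOL-Library.Poly_Mapping\<close>.
  The variables \<open>x\<^sub>1, \<dots>, x\<^sub>n, z\<close> have the indices \<open>0, \<dots>, n - 1, n\<close>. So
  \<open>S = K[x\<^sub>1, \<dots>, x\<^sub>n, z]\<close> is the set of polynomials in the variables \<open>{..n}\<close>,
  and \<open>K[x\<^sub>1, \<dots>, x\<^sub>n]\<close> the set of those in the variables \<open>{..<n}\<close>.
\<close>

type_synonym mon = "nat \<Rightarrow>\<^sub>0 nat"
type_synonym ('i, 'a) mpoly = "('i \<Rightarrow>\<^sub>0 nat) \<Rightarrow>\<^sub>0 'a"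

definition mon_degree :: "mon \<Rightarrow> nat" where
  "mon_degree m = (\<Sum>i\<in>Poly_Mapping.keys m. Poly_Mapping.lookup m i)"

definition monomials :: "nat set \<Rightarrow> nat \<Rightarrow> mon set" where
  "monomials V k = {m. Poly_Mapping.keys m \<subseteq> V \<and> mon_degree m = k}"

definition mono_poly :: "mon \<Rightarrow> (nat, 'a::comm_ring_1) mpoly" where
  "mono_poly m = Poly_Mapping.single m 1"

definition poly_ring :: "'i set \<Rightarrow> ('i, 'a::comm_ring_1) mpoly set" where
  "poly_ring V = {p. \<forall>m\<in>Poly_Mapping.keys p. Poly_Mapping.keys m \<subseteq> V}"

definition homogeneous_of_degree :: "nat \<Rightarrow> (nat, 'a::comm_ring_1) mpoly \<Rightarrow> bool" where
  "homogeneous_of_degree k p \<longleftrightarrow> (\<forall>m\<in>Poly_Mapping.keys p. mon_degree m = k)"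

definition is_ideal :: "nat set \<Rightarrow> (nat, 'a::comm_ring_1) mpoly set \<Rightarrow> bool" where
  "is_ideal V J \<longleftrightarrow> J \<subseteq> poly_ring V \<and> 0 \<in> J \<and> (\<forall>p\<in>J. \<forall>q\<in>J. p + q \<in> J) \<and>
     (\<forall>r\<in>poly_ring V. \<forall>p\<in>J. r * p \<in> J)"

definition ideal_gen :: "nat set \<Rightarrow> (nat, 'a::comm_ring_1) mpoly set \<Rightarrow> (nat, 'a) mpoly set" where
  "ideal_gen V A = is_ideal V hull A"

lemma is_ideal_poly_ring: "is_ideal V (poly_ring V :: (nat, 'a::comm_ring_1) mpoly set)"
  unfolding is_ideal_def
proof (intro conjI ballI)
  fix p q :: "(nat, 'a) mpoly"
  assume "p \<in> poly_ring V" "q \<in> poly_ring V"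
  then show "p + q \<in> poly_ring V"
    using keys_add[of p q] unfolding poly_ring_def by blast
next
  fix r p :: "(nat, 'a) mpoly"
  assume rp: "r \<in> poly_ring V" "p \<in> poly_ring V"
  have "Poly_Mapping.keys m \<subseteq> V" if m: "m \<in> Poly_Mapping.keys (r * p)" for m
  proof -
    from m obtain a b where ab: "m = a + b" "a \<in> Poly_Mapping.keys r" "b \<in> Poly_Mapping.keys p"
      using keys_mult[of r p] by blast
    then have "Poly_Mapping.keys a \<subseteq> V" "Poly_Mapping.keys b \<subseteq> V"
      using rp by (simp_all add: poly_ring_def)
    then show ?thesis
      unfolding ab(1) using keys_add[of a b] by blast
  qed
  then show "r * p \<in> poly_ring V"
    by (simp add: poly_ring_def)
qed (simp_all add: poly_ring_def)

lemma is_ideal_ideal_gen: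
  assumes "A \<subseteq> poly_ring V"
  shows "is_ideal V (ideal_gen V A)"
proof -
  have "ideal_gen V A \<subseteq> poly_ring V"
    unfolding ideal_gen_def using assms is_ideal_poly_ring by (rule hull_minimal)
  then show ?thesis
    unfolding ideal_gen_def hull_def is_ideal_def by simp
qed

text \<open>
  Graded reverse lexicographic order: in equal degree, the smaller monomial is the one with the
  larger exponent at the last variable where the two differ. A smaller index means a larger
  variable, so \<open>x\<^sub>1 > \<dots> > x\<^sub>n > z\<close>.
\<close>

definition grevlex_less :: "mon \<Rightarrow> mon \<Rightarrow> bool" where
  "grevlex_less m m' \<longleftrightarrow> mon_degree m < mon_degree m' \<or>
     (mon_degree m = mon_degree m' \<and>
       (\<exists>i. Poly_Mapping.lookup m i > Poly_Mapping.lookup m' i \<and>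
         (\<forall>j>i. Poly_Mapping.lookup m j = Poly_Mapping.lookup m' j)))"

definition is_lead_mon :: "(nat, 'a::comm_ring_1) mpoly \<Rightarrow> mon \<Rightarrow> bool" where
  "is_lead_mon p m \<longleftrightarrow> m \<in> Poly_Mapping.keys p \<and>
     (\<forall>m'\<in>Poly_Mapping.keys p. m' \<noteq> m \<longrightarrow> grevlex_less m' m)"

definition initial_ideal :: "nat set \<Rightarrow> (nat, 'a::comm_ring_1) mpoly set \<Rightarrow> (nat, 'a) mpoly set" where
  "initial_ideal V J = ideal_gen V {mono_poly m | m. \<exists>p\<in>J. is_lead_mon p m}"

definition is_subfield :: "'a::field set \<Rightarrow> bool" where
  "is_subfield F \<longleftrightarrow> 0 \<in> F \<and> 1 \<in> F \<and> (\<forall>a\<in>F. \<forall>b\<in>F. a - b \<in> F \<and> a * b \<in> F) \<and>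
     (\<forall>a\<in>F. inverse a \<in> F)"

definition mpoly_eval :: "('i \<Rightarrow> 'a::comm_ring_1) \<Rightarrow> ('i, 'a) mpoly \<Rightarrow> 'a" where
  "mpoly_eval c P =
     (\<Sum>m\<in>Poly_Mapping.keys P. Poly_Mapping.lookup P m *
       (\<Prod>i\<in>Poly_Mapping.keys m. c i ^ Poly_Mapping.lookup m i))"

text \<open>
  This is independence of the family \<open>c\<close> indexed by \<open>X\<close>, not just of its set of values;
  in particular \<open>c\<close> is injective on \<open>X\<close>.
\<close>

definition alg_independent :: "'a::field set \<Rightarrow> 'i set \<Rightarrow> ('i \<Rightarrow> 'a) \<Rightarrow> bool" where
  "alg_independent F X c \<longleftrightarrow>
     (\<forall>P\<in>poly_ring X. (\<forall>m. Poly_Mapping.lookup P m \<in> F) \<longrightarrow> mpoly_eval c P = 0 \<longrightarrow> P = 0)"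

text \<open>
  \<open>hs\<close> is a list of generic generators, of degrees \<open>es\<close>, of a generic ideal in the variables \<open>V\<close>.
  The pair \<open>(j, m)\<close> indexes the coefficient of the monomial \<open>m\<close> in \<open>hs ! j\<close>.
\<close>

definition generic_generators ::
    "'a::field set \<Rightarrow> nat set \<Rightarrow> nat list \<Rightarrow> (nat, 'a) mpoly list \<Rightarrow> bool" where
  "generic_generators F V es hs \<longleftrightarrow>
     length hs = length es \<and> (\<forall>e\<in>set es. e \<ge> 1) \<and>
     (\<forall>j<length hs. hs ! j \<in> poly_ring V \<and> homogeneous_of_degree (es ! j) (hs ! j)) \<and>
     alg_independent F {(j, m). j < length hs \<and> m \<in> monomials V (es ! j)}
       (\<lambda>(j, m). Poly_Mapping.lookup (hs ! j) m)"

definition standard_monomials ::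
    "nat \<Rightarrow> (nat, 'a::comm_ring_1) mpoly set \<Rightarrow> nat \<Rightarrow> mon set" where
  "standard_monomials n I k =
     {m \<in> monomials {..<n} k. mono_poly m \<notin> initial_ideal {..n} I}"

end

theory Submission
  imports Defs "Jordan_Normal_Form.Determinant"
begin

text \<open>
  Write \<open>e\<^sub>i\<close> for the degree of the generator \<open>f\<^sub>i\<close>; the last generator \<open>g\<close> has degree \<open>d\<close>. In a fixed
  degree the reverse lexicographic order compares the exponents of \<open>z\<close> first, so adding multiples of a power of \<open>z\<close> to an ideal leaves the leading
  monomials with a smaller exponent of \<open>z\<close> unchanged (\<open>lead_mon_without_last_power\<close>). The plan
  is to show that in degree \<open>d + s\<close>, for \<open>s \<le> \<delta>\<close>, all monomials with exponent of \<open>z\<close> at most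
  \<open>d + 2 s - \<delta>\<close> are leading monomials of \<open>(I, g)\<close>; counting dimensions then shows that modulo
  \<open>in(I)\<close> the initial ideal needs no other generators.

  Genericity enters in one way only (\<open>monomials_subset_generic_ideal\<close>): if, for some choice of
  generators of the given degrees, all monomials of a certain degree lie in the ideal, possibly
  enlarged by fixed monomials, then the same holds for the generic generators, because some
  determinant is a nonzero polynomial in the coefficients. This replaces all the theory of regular
  sequences by two explicit examples.

  The first example consists of the pure powers of the variables \<open>x\<^sub>i\<close> with exponents \<open>e\<^sub>i\<close>. It shows that
  the generic ideals are at least as large as expected, where the expected codimension counts the
  monomials of the box \<open>m\<^sub>i < e\<^sub>i\<close>. They are not larger, since a new generator of degree \<open>e\<close> adds
  at most the codimension in degree \<open>k - e\<close> to the dimension in degree \<open>k\<close>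
  (\<open>card_lead_mons_insert_le\<close>, \<open>card_lead_mons_partial_ideal\<close>). The same example, with \<open>z\<close> adjoined,
  bounds the number of elements of \<open>B\<^sub>j\<close> by the number of box monomials of degree \<open>j\<close>.

  The second example carries the theorem. Let \<open>U\<^sub>0 = 0\<close>, \<open>U\<^sub>1 = 1\<close>, \<open>U\<^sub>k\<^sub>+\<^sub>2 = x U\<^sub>k\<^sub>+\<^sub>1 - z\<^sup>2 U\<^sub>k\<close> be the Lucas
  polynomials, homogenized Chebyshev polynomials of the second kind. They satisfy
  \<open>U\<^sub>e U\<^sub>b\<^sub>+\<^sub>1 = z\<^sup>2\<^sup>b U\<^sub>e\<^sub>-\<^sub>b + U\<^sub>e\<^sub>+\<^sub>1 U\<^sub>b\<close> for \<open>b < e\<close> (\<open>lucas_mult_lucas\<close>). Hence modulo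
  the polynomials \<open>U\<^bsub>e\<^sub>i + 1\<^esub>(x\<^sub>i)\<close>, multiplication by \<open>g = z\<^bsup>d - \<delta>\<^esup> \<Prod>\<^sub>i U\<^bsub>e\<^sub>i\<^esub>(x\<^sub>i)\<close> sends the basis element
  \<open>\<Prod>\<^sub>i U\<^bsub>b\<^sub>i + 1\<^esub>(x\<^sub>i)\<close> to a power of \<open>z\<close> times the one with the exponents \<open>b\<^sub>i\<close> replaced by
  \<open>e\<^sub>i - 1 - b\<^sub>i\<close>: it realizes the duality of the complete intersection, in every characteristic.
  The leading monomials obtained in this way are all those that the theorem predicts
  (\<open>lucas_ideal_contains_monomials\<close>, \<open>lead_mons_full_ideal\<close>).

  Finally the number of new leading monomials in degree \<open>d + s\<close> is at most the number of box
  monomials of degree \<open>s\<close>, and the reflection of the box turns this into the number of monomials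
  already found (\<open>card_lead_mons_full_le\<close>).
\<close>

abbreviation "keys \<equiv> Poly_Mapping.keys"
abbreviation "lookup \<equiv> Poly_Mapping.lookup"
abbreviation "single \<equiv> Poly_Mapping.single"

(* As a destruction rule for the classical reasoner this fact lets goals about sets of keys diverge. *)
declare lookup_eq_zero_in_keys_contradict [rule del]

section \<open>Monomials and the graded reverse lexicographic order\<close>

lemma keys_add_mon: "keys (a + b :: 'i \<Rightarrow>\<^sub>0 nat) = keys a \<union> keys b"
  by (auto simp: in_keys_iff lookup_add)

lemma mon_degree_eq_sum:
  assumes "finite A" "keys m \<subseteq> A"
  shows "mon_degree m = sum (lookup m) A"
  unfolding mon_degree_def using assms
  by (intro sum.mono_neutral_left) (auto simp: in_keys_iff)

lemma mon_degree_add: "mon_degree (a + b) = mon_degree a + mon_degree b"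
proof -
  have "mon_degree c = sum (lookup c) (keys a \<union> keys b)" if "keys c \<subseteq> keys a \<union> keys b" for c
    using that by (intro mon_degree_eq_sum) auto
  then show ?thesis
    by (simp add: keys_add_mon lookup_add sum.distrib)
qed

lemma mon_degree_single [simp]: "mon_degree (single i k) = k"
  by (simp add: mon_degree_def)

lemma mon_degree_zero [simp]: "mon_degree 0 = 0"
  by (simp add: mon_degree_def)

lemma lookup_le_mon_degree: "lookup m i \<le> mon_degree m"
  unfolding mon_degree_def
  by (cases "i \<in> keys m") (auto simp: in_keys_iff intro: member_le_sum)

lemma mon_eq_add_of_le:
  assumes "\<And>i. lookup a i \<le> lookup m i"
  obtains b :: "'i \<Rightarrow>\<^sub>0 nat" where "m = a + b" "keys b \<subseteq> keys m"
proof
  show "m = a + (m - a)"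
    using assms by (intro poly_mapping_eqI) (simp add: lookup_add lookup_minus)
  show "keys (m - a) \<subseteq> keys m"
    by (auto simp: in_keys_iff lookup_minus)
qed

lemma finite_monomials: "finite V \<Longrightarrow> finite (monomials V k)"
proof -
  assume V: "finite V"
  have "lookup ` monomials V k \<subseteq>
      {f. \<forall>i. (i \<in> V \<longrightarrow> f i \<in> {..k}) \<and> (i \<notin> V \<longrightarrow> f i = 0)}"
    using lookup_le_mon_degree by (fastforce simp: monomials_def in_keys_iff)
  moreover have "finite {f. \<forall>i. (i \<in> V \<longrightarrow> f i \<in> {..k}) \<and> (i \<notin> V \<longrightarrow> f i = 0)}"
    using V by (intro finite_set_of_finite_funs) auto
  ultimately have "finite (lookup ` monomials V k)"
    by (rule finite_subset)
  then show ?thesis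
    by (rule finite_imageD) (auto intro: inj_onI simp: lookup_inject)
qed

lemma grevlex_irrefl: "\<not> grevlex_less m m"
  by (simp add: grevlex_less_def)

lemma grevlex_trans:
  assumes "grevlex_less a b" "grevlex_less b c"
  shows "grevlex_less a c"
proof (cases "mon_degree a = mon_degree b \<and> mon_degree b = mon_degree c")
  case True
  then obtain i j where
    i: "lookup a i > lookup b i" "\<forall>l>i. lookup a l = lookup b l" and
    j: "lookup b j > lookup c j" "\<forall>l>j. lookup b l = lookup c l"
    using assms by (auto simp: grevlex_less_def)
  have "lookup a (max i j) > lookup c (max i j)"
    using i j by (cases i j rule: linorder_cases) (auto simp: max_def)
  then show ?thesis
    using True i j by (auto simp: grevlex_less_def intro!: exI[of _ "max i j"])
qed (use assms in \<open>auto simp: grevlex_less_def\<close>)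

lemma grevlex_asym: "grevlex_less a b \<Longrightarrow> \<not> grevlex_less b a"
  using grevlex_irrefl grevlex_trans by blast

lemma grevlex_total:
  assumes "a \<noteq> b"
  shows "grevlex_less a b \<or> grevlex_less b a"
proof -
  define D where "D = {i. lookup a i \<noteq> lookup b i}"
  have mem: "i \<in> D \<longleftrightarrow> lookup a i \<noteq> lookup b i" for i
    by (simp add: D_def)
  have "D \<subseteq> keys a \<union> keys b"
    by (auto simp: D_def in_keys_iff)
  then have "finite D"
    by (rule finite_subset) auto
  moreover have "D \<noteq> {}"
    using assms by (auto simp: D_def intro: poly_mapping_eqI)
  ultimately have "Max D \<in> D" "\<And>j. j > Max D \<Longrightarrow> j \<notin> D"
    by (auto dest: Max_ge)
  then have D: "lookup a (Max D) \<noteq> lookup b (Max D)" "\<forall>j>Max D. lookup a j = lookup b j"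
    using mem by blast+
  consider "mon_degree a < mon_degree b" | "mon_degree b < mon_degree a"
    | "mon_degree a = mon_degree b" "lookup a (Max D) > lookup b (Max D)"
    | "mon_degree a = mon_degree b" "lookup a (Max D) < lookup b (Max D)"
    using D(1) by linarith
  then show ?thesis
    unfolding grevlex_less_def using D(2) by cases force+
qed

lemma grevlex_add_left: "grevlex_less a b \<Longrightarrow> grevlex_less (c + a) (c + b)"
  by (auto simp: grevlex_less_def mon_degree_add lookup_add)

lemma grevlex_add_right: "grevlex_less a b \<Longrightarrow> grevlex_less (a + c) (b + c)"
  by (metis add.commute grevlex_add_left)

text \<open>
  The feature of the reverse lexicographic order on which everything rests: among monomials of one
  degree, a larger exponent at the last variable alone makes a monomial smaller.
\<close>

lemma grevlex_less_last:
  assumes "m \<in> monomials {..n} k" "m' \<in> monomials {..n} k" "lookup m n > lookup m' n"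
  shows "grevlex_less m m'"
proof -
  have "lookup m j = lookup m' j" if "j > n" for j
  proof -
    have "j \<notin> keys m" "j \<notin> keys m'"
      using assms(1,2) that by (auto simp: monomials_def)
    then show ?thesis
      by (simp add: in_keys_iff)
  qed
  then show ?thesis
    using assms unfolding grevlex_less_def monomials_def by auto
qed

lemma grevlex_max_exists:
  assumes "finite A" "A \<noteq> {}"
  shows "\<exists>m\<in>A. \<forall>m'\<in>A. m' \<noteq> m \<longrightarrow> grevlex_less m' m"
  using assms
proof (induction A rule: finite_ne_induct)
  case (singleton x)
  then show ?case
    by simp
next
  case (insert a A)
  then obtain m where m: "m \<in> A" "\<forall>m'\<in>A. m' \<noteq> m \<longrightarrow> grevlex_less m' m"
    by blast
  show ?case
  proof (cases "grevlex_less m a")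
    case True
    then have "\<forall>m'\<in>insert a A. m' \<noteq> a \<longrightarrow> grevlex_less m' a"
    proof (intro ballI impI)
      fix m' assume "m' \<in> insert a A" "m' \<noteq> a"
      then have "m' = m \<or> grevlex_less m' m"
        using m(2) by blast
      then show "grevlex_less m' a"
        using True grevlex_trans[of m' m a] by blast
    qed
    then show ?thesis
      by blast
  next
    case False
    then have "\<forall>m'\<in>insert a A. m' \<noteq> m \<longrightarrow> grevlex_less m' m"
      using m grevlex_total[of a m] by blast
    then show ?thesis
      using m(1) by blast
  qed
qed

section \<open>Leading monomials\<close>

lemma lead_mon_exists:
  assumes "p \<noteq> 0"
  shows "\<exists>m. is_lead_mon p m"
proof -
  have "keys p \<noteq> {}"
  proof
    assume "keys p = {}"
    then have "lookup p m = lookup 0 m" for m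
      by (simp add: in_keys_iff flip: not_in_keys_iff_lookup_eq_zero)
    with assms show False
      by (blast intro: poly_mapping_eqI)
  qed
  from grevlex_max_exists[OF finite_keys this] obtain m
    where "m \<in> keys p" "\<forall>m'\<in>keys p. m' \<noteq> m \<longrightarrow> grevlex_less m' m" ..
  then show ?thesis
    by (auto simp: is_lead_mon_def)
qed

lemma lead_mon_unique:
  assumes "is_lead_mon p m" "is_lead_mon p m'"
  shows "m = m'"
proof (rule ccontr)
  assume "m \<noteq> m'"
  then have "grevlex_less m m'" "grevlex_less m' m"
    using assms by (simp_all add: is_lead_mon_def)
  then show False
    using grevlex_asym by blast
qed

lemma keys_mono_poly [simp]: "keys (mono_poly m :: (nat, 'a::comm_ring_1) mpoly) = {m}"
  by (simp add: mono_poly_def)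

lemma lead_mon_mono_poly: "is_lead_mon (mono_poly m :: (nat, 'a::comm_ring_1) mpoly) m"
  by (simp add: is_lead_mon_def)

lemma mono_poly_add: "mono_poly (a + b) = (mono_poly a * mono_poly b :: (nat, 'a::comm_ring_1) mpoly)"
  by (simp add: mono_poly_def mult_single)

lemma mono_poly_zero [simp]: "mono_poly 0 = (1 :: (nat, 'a::comm_ring_1) mpoly)"
  by (simp add: mono_poly_def)

lemma poly_eq_sum_singles: "p = (\<Sum>m\<in>keys p. single m (lookup p m))"
proof (rule poly_mapping_eqI)
  fix m
  have "lookup (\<Sum>a\<in>keys p. single a (lookup p a)) m = (\<Sum>a\<in>keys p. if a = m then lookup p a else 0)"
    unfolding lookup_sum by (intro sum.cong) (auto simp: lookup_single when_def)
  also have "\<dots> = lookup p m"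
    by (simp add: in_keys_iff)
  finally show "lookup p m = lookup (\<Sum>a\<in>keys p. single a (lookup p a)) m"
    by simp
qed

lemma lookup_single_mult:
  fixes q :: "('i, 'a::comm_ring_1) mpoly"
  shows "lookup (single a c * q) (a + b) = c * lookup q b"
proof -
  have "single a c * q = (\<Sum>m\<in>keys q. single (a + m) (c * lookup q m))"
    by (subst poly_eq_sum_singles[of q]) (simp add: sum_distrib_left mult_single)
  then have "lookup (single a c * q) (a + b) = (\<Sum>m\<in>keys q. if m = b then c * lookup q m else 0)"
    by (simp add: lookup_sum lookup_single when_def)
  then show ?thesis
    by (simp add: in_keys_iff)
qed

lemma keys_single_mult:
  fixes q :: "('i, 'a::comm_ring_1) mpoly"
  shows "keys (single a c * q) \<subseteq> (+) a ` keys q"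
  using keys_mult[of "single a c" q] by (auto split: if_splits)

text \<open>
  The product of the leading terms cannot cancel: every other product of two terms is strictly
  smaller, because the order is compatible with multiplication.
\<close>

lemma lead_mon_mult:
  fixes p q :: "(nat, 'a::field) mpoly"
  assumes p: "is_lead_mon p m" and q: "is_lead_mon q m'"
  shows "is_lead_mon (p * q) (m + m')"
proof -
  have small: "grevlex_less (a + b) (m + m')"
    if "a \<in> keys p" "b \<in> keys q" "a \<noteq> m \<or> b \<noteq> m'" for a b
  proof -
    have "a = m \<or> grevlex_less a m" "b = m' \<or> grevlex_less b m'"
      using that p q by (auto simp: is_lead_mon_def)
    then show ?thesis
      using that(3) grevlex_add_left[of b m' a] grevlex_add_left[of b m' m] grevlex_add_right[of a m m']
        grevlex_trans by blast
  qed
  have "p * q = (\<Sum>a\<in>keys p. single a (lookup p a) * q)"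
    by (subst poly_eq_sum_singles[of p]) (simp add: sum_distrib_right)
  then have "lookup (p * q) (m + m') = (\<Sum>a\<in>keys p. lookup (single a (lookup p a) * q) (m + m'))"
    by (simp add: lookup_sum)
  also have "\<dots> = (\<Sum>a\<in>keys p. if a = m then lookup p m * lookup q m' else 0)"
  proof (intro sum.cong refl)
    fix a assume a: "a \<in> keys p"
    show "lookup (single a (lookup p a) * q) (m + m') = (if a = m then lookup p m * lookup q m' else 0)"
    proof (cases "a = m")
      case False
      have "m + m' \<notin> (+) a ` keys q"
        using small[OF a] False grevlex_irrefl by force
      then have "m + m' \<notin> keys (single a (lookup p a) * q)"
        using keys_single_mult by blast
      then show ?thesis
        using False by (simp add: in_keys_iff)
    qed (simp add: lookup_single_mult)
  qed
  also have "\<dots> = lookup p m * lookup q m'"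
    using p by (simp add: is_lead_mon_def)
  also have "\<dots> \<noteq> 0"
    using p q by (simp add: is_lead_mon_def in_keys_iff)
  finally have "m + m' \<in> keys (p * q)"
    by (simp add: in_keys_iff)
  moreover have "grevlex_less k (m + m')" if "k \<in> keys (p * q)" "k \<noteq> m + m'" for k
    using keys_mult[of p q] that small by blast
  ultimately show ?thesis
    by (simp add: is_lead_mon_def)
qed

section \<open>Ideals and their homogeneous components\<close>

lemma poly_ring_zero [simp]: "0 \<in> poly_ring V"
  and poly_ring_one [simp]: "1 \<in> poly_ring V"
  by (simp_all add: poly_ring_def)

lemma poly_ring_single: "keys a \<subseteq> V \<Longrightarrow> single a c \<in> poly_ring V"
  by (simp add: poly_ring_def)

lemma poly_ring_mono_poly: "keys a \<subseteq> V \<Longrightarrow> mono_poly a \<in> poly_ring V"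
  by (simp add: mono_poly_def poly_ring_single)

lemma poly_ring_add: "p \<in> poly_ring V \<Longrightarrow> q \<in> poly_ring V \<Longrightarrow> p + q \<in> poly_ring V"
  using keys_add[of p q] unfolding poly_ring_def by blast

lemma poly_ring_mult:
  assumes "p \<in> poly_ring V" "q \<in> poly_ring V"
  shows "p * q \<in> poly_ring V"
  unfolding poly_ring_def
proof (intro CollectI ballI)
  fix m assume "m \<in> keys (p * q)"
  then obtain a b where "m = a + b" "a \<in> keys p" "b \<in> keys q"
    using keys_mult[of p q] by blast
  then show "keys m \<subseteq> V"
    using assms by (auto simp: poly_ring_def keys_add_mon)
qed

lemma poly_ring_uminus:
  "p \<in> poly_ring V \<Longrightarrow> - p \<in> poly_ring V"
  by (simp add: poly_ring_def in_keys_iff)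

lemma poly_ring_diff: "p \<in> poly_ring V \<Longrightarrow> q \<in> poly_ring V \<Longrightarrow> p - q \<in> poly_ring V"
  using poly_ring_add[of p V "- q"] poly_ring_uminus by force

lemma poly_ring_prod: "(\<And>i. i \<in> A \<Longrightarrow> f i \<in> poly_ring V) \<Longrightarrow> prod f A \<in> poly_ring V"
  by (induction A rule: infinite_finite_induct) (simp_all add: poly_ring_mult)

lemma ideal_gen_superset: "A \<subseteq> ideal_gen V A"
  unfolding ideal_gen_def by (rule hull_subset)

lemma ideal_gen_mono: "A \<subseteq> B \<Longrightarrow> ideal_gen V A \<subseteq> ideal_gen V B"
  unfolding ideal_gen_def by (rule hull_mono)

lemma ideal_gen_minimal: "A \<subseteq> J \<Longrightarrow> is_ideal V J \<Longrightarrow> ideal_gen V A \<subseteq> J"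
  unfolding ideal_gen_def by (rule hull_minimal)

lemma is_ideal_add: "is_ideal V J \<Longrightarrow> p \<in> J \<Longrightarrow> q \<in> J \<Longrightarrow> p + q \<in> J"
  and is_ideal_mult: "is_ideal V J \<Longrightarrow> r \<in> poly_ring V \<Longrightarrow> p \<in> J \<Longrightarrow> r * p \<in> J"
  and is_ideal_zero: "is_ideal V J \<Longrightarrow> 0 \<in> J"
  and is_ideal_subset: "is_ideal V J \<Longrightarrow> J \<subseteq> poly_ring V"
  by (simp_all add: is_ideal_def)

lemma is_ideal_diff:
  assumes "is_ideal V J" "p \<in> J" "q \<in> J"
  shows "p - q \<in> J"
  using is_ideal_add[OF assms(1,2) is_ideal_mult[OF assms(1) poly_ring_uminus[OF poly_ring_one] assms(3)]]
  by simp

text \<open>Multiplication by a polynomial only needs to be checked for multiplication by terms.\<close>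

lemma is_idealI:
  assumes "J \<subseteq> poly_ring V" "0 \<in> J" "\<And>p q. p \<in> J \<Longrightarrow> q \<in> J \<Longrightarrow> p + q \<in> J"
    and "\<And>a c p. keys a \<subseteq> V \<Longrightarrow> p \<in> J \<Longrightarrow> single a c * p \<in> J"
  shows "is_ideal V J"
proof -
  have "r * p \<in> J" if r: "r \<in> poly_ring V" and p: "p \<in> J" for r p
  proof -
    have "(\<Sum>a\<in>A. single a (lookup r a) * p) \<in> J" if "A \<subseteq> keys r" for A
      using finite_subset[OF that finite_keys] that
    proof (induction A rule: finite_induct)
      case (insert a A)
      then have "keys a \<subseteq> V"
        using r by (auto simp: poly_ring_def)
      with insert assms(3,4) p show ?case
        by simp
    qed (use assms(2) in simp)
    then have "(\<Sum>a\<in>keys r. single a (lookup r a)) * p \<in> J"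
      by (simp add: sum_distrib_right)
    then show ?thesis
      by (simp flip: poly_eq_sum_singles)
  qed
  with assms show ?thesis
    by (simp add: is_ideal_def)
qed

text \<open>
  The polynomials of the form on the right already make up an ideal that contains all the generators.
\<close>

lemma ideal_gen_insertE:
  fixes g :: "(nat, 'a::comm_ring_1) mpoly"
  assumes "A \<subseteq> poly_ring V" "g \<in> poly_ring V" "p \<in> ideal_gen V (insert g A)"
  obtains q r where "q \<in> ideal_gen V A" "r \<in> poly_ring V" "p = q + r * g"
proof -
  let ?I = "ideal_gen V A"
  let ?J = "{q + r * g | q r. q \<in> ?I \<and> r \<in> poly_ring V}"
  note I = is_ideal_ideal_gen[OF assms(1)]
  have "is_ideal V ?J"
    unfolding is_ideal_def
  proof (intro conjI ballI)
    show "?J \<subseteq> poly_ring V"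
      using is_ideal_subset[OF I] assms(2) by (auto intro!: poly_ring_add poly_ring_mult)
    show "0 \<in> ?J"
      using is_ideal_zero[OF I] by (auto intro!: exI[of _ 0])
  next
    fix p p' assume "p \<in> ?J" "p' \<in> ?J"
    then obtain q r q' r' where "q \<in> ?I" "r \<in> poly_ring V" "q' \<in> ?I" "r' \<in> poly_ring V"
      and p: "p = q + r * g" "p' = q' + r' * g"
      by blast
    moreover have "p + p' = (q + q') + (r + r') * g"
      unfolding p by (simp add: algebra_simps)
    ultimately show "p + p' \<in> ?J"
      using is_ideal_add[OF I] poly_ring_add by blast
  next
    fix s p :: "(nat, 'a) mpoly" assume "s \<in> poly_ring V" "p \<in> ?J"
    then obtain q r where "q \<in> ?I" "r \<in> poly_ring V" "s \<in> poly_ring V" and p: "p = q + r * g"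
      by blast
    moreover have "s * p = s * q + (s * r) * g"
      unfolding p by (simp add: algebra_simps)
    ultimately show "s * p \<in> ?J"
      using is_ideal_mult[OF I] poly_ring_mult by blast
  qed
  moreover have "insert g A \<subseteq> ?J"
  proof
    fix a assume "a \<in> insert g A"
    then show "a \<in> ?J"
    proof
      assume "a = g"
      then show ?thesis
        by (intro CollectI exI[of _ 0] exI[of _ 1]) (simp add: is_ideal_zero[OF I])
    next
      assume "a \<in> A"
      then show ?thesis
        using ideal_gen_superset[of A V] by (intro CollectI exI[of _ a] exI[of _ 0]) auto
    qed
  qed
  ultimately have "p \<in> ?J"
    using ideal_gen_minimal[of "insert g A" ?J V] assms(3) by blast
  then show ?thesis
    using that by blast
qed

definition hom_component :: "nat \<Rightarrow> (nat, 'a::comm_ring_1) mpoly \<Rightarrow> (nat, 'a) mpoly" where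
  "hom_component k p = Poly_Mapping.mapp (\<lambda>m c. c when mon_degree m = k) p"

lemma lookup_hom_component: "lookup (hom_component k p) m = (lookup p m when mon_degree m = k)"
  by (auto simp: hom_component_def lookup_mapp when_def in_keys_iff)

lemma keys_hom_component: "keys (hom_component k p) = {m \<in> keys p. mon_degree m = k}"
  by (auto simp: in_keys_iff lookup_hom_component when_def split: if_splits)

lemma hom_component_zero [simp]: "hom_component k 0 = 0"
  by (intro poly_mapping_eqI) (simp add: lookup_hom_component)

lemma hom_component_add: "hom_component k (p + q) = hom_component k p + hom_component k q"
  by (intro poly_mapping_eqI) (simp add: lookup_hom_component lookup_add when_def)

lemma hom_component_sum: "hom_component k (sum f A) = (\<Sum>i\<in>A. hom_component k (f i))"
  by (induction A rule: infinite_finite_induct) (simp_all add: hom_component_add)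

lemma homogeneous_hom_component: "homogeneous_of_degree k (hom_component k p)"
  by (simp add: homogeneous_of_degree_def keys_hom_component)

lemma poly_ring_hom_component: "p \<in> poly_ring V \<Longrightarrow> hom_component k p \<in> poly_ring V"
  by (simp add: poly_ring_def keys_hom_component)

lemma hom_component_homogeneous:
  assumes "homogeneous_of_degree d p"
  shows "hom_component k p = (if k = d then p else 0)"
proof (rule poly_mapping_eqI)
  fix m
  show "lookup (hom_component k p) m = lookup (if k = d then p else 0) m"
    using assms
    by (cases "m \<in> keys p") (auto simp: lookup_hom_component homogeneous_of_degree_def when_def in_keys_iff)
qed

lemma hom_component_single_mult:
  "hom_component k (single a c * p) = (if mon_degree a \<le> k then single a c * hom_component (k - mon_degree a) p else 0)"
proof (rule poly_mapping_eqI)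
  fix m
  show "lookup (hom_component k (single a c * p)) m =
    lookup (if mon_degree a \<le> k then single a c * hom_component (k - mon_degree a) p else 0) m"
  proof (cases "\<exists>b. m = a + b")
    case True
    then obtain b where b: "m = a + b" ..
    show ?thesis
      unfolding b by (auto simp: lookup_hom_component lookup_single_mult mon_degree_add when_def)
  next
    case False
    then have "m \<notin> keys (single a c * q)" for q
      using keys_single_mult[of a c q] by blast
    then show ?thesis
      by (auto simp: lookup_hom_component in_keys_iff when_def)
  qed
qed

lemma hom_component_mult_homogeneous:
  assumes "homogeneous_of_degree d g"
  shows "hom_component k (r * g) = (if d \<le> k then hom_component (k - d) r * g else 0)"
proof -
  have *: "hom_component k (single a c * g) = (if d \<le> k then hom_component (k - d) (single a c) * g else 0)" for a c
  proof -
    have "hom_component (k - d) (single a c) = (if k - d = mon_degree a then single a c else 0)"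
      by (intro hom_component_homogeneous) (simp add: homogeneous_of_degree_def)
    then show ?thesis
      using assms by (auto simp: hom_component_single_mult hom_component_homogeneous)
  qed
  have "hom_component k (r * g) = (\<Sum>a\<in>keys r. hom_component k (single a (lookup r a) * g))"
    by (subst poly_eq_sum_singles[of r]) (simp add: sum_distrib_right hom_component_sum)
  also have "\<dots> = (if d \<le> k then (\<Sum>a\<in>keys r. hom_component (k - d) (single a (lookup r a))) * g else 0)"
    by (simp add: * sum_distrib_right)
  also have "(\<Sum>a\<in>keys r. hom_component (k - d) (single a (lookup r a))) = hom_component (k - d) r"
    by (subst (3) poly_eq_sum_singles[of r]) (simp add: hom_component_sum)
  finally show ?thesis .
qed

lemma homogeneous_mult:
  assumes "homogeneous_of_degree d p" "homogeneous_of_degree e q"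
  shows "homogeneous_of_degree (d + e) (p * q)"
  using assms keys_mult[of p q] by (fastforce simp: homogeneous_of_degree_def mon_degree_add)

lemma homogeneous_mono_poly: "mon_degree m = k \<Longrightarrow> homogeneous_of_degree k (mono_poly m)"
  by (simp add: homogeneous_of_degree_def)

definition homogeneous_set :: "(nat, 'a::comm_ring_1) mpoly set \<Rightarrow> bool" where
  "homogeneous_set A \<longleftrightarrow> (\<forall>p\<in>A. \<exists>d. homogeneous_of_degree d p)"

text \<open>
  The polynomials all of whose components lie in the ideal form an ideal themselves, and it
  contains the homogeneous generators.
\<close>

lemma hom_component_in_ideal_gen:
  assumes A: "A \<subseteq> poly_ring V" "homogeneous_set A" and p: "p \<in> ideal_gen V A"
  shows "hom_component k p \<in> ideal_gen V A"
proof -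
  let ?I = "ideal_gen V A"
  note I = is_ideal_ideal_gen[OF A(1)]
  have "is_ideal V {p \<in> poly_ring V. \<forall>k. hom_component k p \<in> ?I}"
    by (rule is_idealI)
      (auto simp: hom_component_add hom_component_single_mult is_ideal_zero[OF I] is_ideal_add[OF I] is_ideal_mult[OF I]
        poly_ring_single poly_ring_mult poly_ring_add)
  moreover have "A \<subseteq> {p \<in> poly_ring V. \<forall>k. hom_component k p \<in> ?I}"
  proof
    fix q assume q: "q \<in> A"
    then obtain d where "homogeneous_of_degree d q"
      using A(2) by (auto simp: homogeneous_set_def)
    then show "q \<in> {p \<in> poly_ring V. \<forall>k. hom_component k p \<in> ?I}"
      using q A(1) ideal_gen_superset[of A V] is_ideal_zero[OF I] by (auto simp: hom_component_homogeneous)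
  qed
  ultimately show ?thesis
    using ideal_gen_minimal[of A _ V] p by blast
qed

section \<open>Counting leading monomials\<close>

text \<open>
  Scalar multiplication, which makes the polynomials a vector space, so that the facts about spans
  and independent sets apply.
\<close>

definition scale_poly :: "'a::comm_ring_1 \<Rightarrow> (nat, 'a) mpoly \<Rightarrow> (nat, 'a) mpoly" where
  "scale_poly c p = single 0 c * p"

lemma lookup_scale_poly [simp]: "lookup (scale_poly c p) m = c * lookup p m"
  using lookup_single_mult[of 0 c p m] by (simp add: scale_poly_def)

lemma keys_scale_poly: "keys (scale_poly c p) \<subseteq> keys p"
  by (auto simp: in_keys_iff)

global_interpretation mpv: vector_space "scale_poly :: 'a::field \<Rightarrow> _"
  by standard (simp_all add: scale_poly_def algebra_simps single_add mult_single flip: mult.assoc)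

lemma homogeneous_zero [simp]: "homogeneous_of_degree k 0"
  by (simp add: homogeneous_of_degree_def)

lemma homogeneous_add:
  "homogeneous_of_degree k p \<Longrightarrow> homogeneous_of_degree k q \<Longrightarrow> homogeneous_of_degree k (p + q)"
  using keys_add[of p q] by (auto simp: homogeneous_of_degree_def)

lemma homogeneous_scale_poly: "homogeneous_of_degree k p \<Longrightarrow> homogeneous_of_degree k (scale_poly c p)"
  using keys_scale_poly[of c p] by (auto simp: homogeneous_of_degree_def)

lemma is_ideal_scale_poly: "is_ideal V J \<Longrightarrow> p \<in> J \<Longrightarrow> scale_poly c p \<in> J"
  unfolding scale_poly_def by (rule is_ideal_mult) (simp_all add: poly_ring_single)

definition graded_part :: "nat \<Rightarrow> (nat, 'a::comm_ring_1) mpoly set \<Rightarrow> (nat, 'a) mpoly set" where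
  "graded_part k J = {p \<in> J. homogeneous_of_degree k p}"

lemma subspace_graded_part: "is_ideal V J \<Longrightarrow> mpv.subspace (graded_part k J)"
  unfolding mpv.subspace_def graded_part_def
  by (simp add: is_ideal_zero is_ideal_add is_ideal_scale_poly homogeneous_add homogeneous_scale_poly)

definition lead_mons :: "nat \<Rightarrow> (nat, 'a::comm_ring_1) mpoly set \<Rightarrow> mon set" where
  "lead_mons k J = {m. mon_degree m = k \<and> (\<exists>p\<in>J. is_lead_mon p m)}"

lemma lead_mons_subset_monomials: "J \<subseteq> poly_ring V \<Longrightarrow> lead_mons k J \<subseteq> monomials V k"
  by (auto simp: lead_mons_def monomials_def is_lead_mon_def poly_ring_def)

text \<open>
  In a graded order a leading monomial of a homogeneous ideal is the leading monomial of the
  homogeneous component of its degree.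
\<close>

lemma lead_mons_homogeneousE:
  assumes "A \<subseteq> poly_ring V" "homogeneous_set A" "m \<in> lead_mons k (ideal_gen V A)"
  obtains p where "p \<in> graded_part k (ideal_gen V A)" "is_lead_mon p m"
proof -
  obtain p where p: "p \<in> ideal_gen V A" "is_lead_mon p m" "mon_degree m = k"
    using assms(3) by (auto simp: lead_mons_def)
  have "hom_component k p \<in> graded_part k (ideal_gen V A)"
    using hom_component_in_ideal_gen[OF assms(1,2) p(1)] homogeneous_hom_component by (auto simp: graded_part_def)
  moreover have "is_lead_mon (hom_component k p) m"
    using p by (simp add: is_lead_mon_def keys_hom_component)
  ultimately show ?thesis
    using that by blast
qed

text \<open>Polynomials with distinct leading monomials are linearly independent.\<close>

lemma card_lead_mons_le:
  fixes Y :: "(nat, 'a::field) mpoly set"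
  assumes Y: "finite Y" and L: "\<And>m. m \<in> L \<Longrightarrow> \<exists>p\<in>mpv.span Y. is_lead_mon p m"
  shows "card L \<le> card Y"
proof -
  obtain w where w: "\<And>m. m \<in> L \<Longrightarrow> w m \<in> mpv.span Y" "\<And>m. m \<in> L \<Longrightarrow> is_lead_mon (w m) m"
    using L by metis
  have "inj_on w L"
  proof (rule inj_onI)
    fix m m' assume "m \<in> L" "m' \<in> L" "w m = w m'"
    then show "m = m'"
      using w(2)[of m] w(2)[of m'] lead_mon_unique[of "w m" m m'] by simp
  qed
  have "mpv.independent (w ` L)"
    unfolding mpv.dependent_explicit
  proof (rule notI, elim exE conjE bexE)
    fix t u v
    assume t: "finite t" "t \<subseteq> w ` L" "(\<Sum>v\<in>t. scale_poly (u v) v) = 0" and v: "v \<in> t" "u v \<noteq> 0"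
    define S where "S = {m \<in> L. w m \<in> t \<and> u (w m) \<noteq> 0}"
    have "w ` S \<subseteq> t"
      by (auto simp: S_def)
    then have "finite (w ` S)"
      using t(1) finite_subset by blast
    then have "finite S"
      by (rule finite_imageD) (use \<open>inj_on w L\<close> in \<open>auto simp: S_def intro: inj_on_subset\<close>)
    moreover have "S \<noteq> {}"
      using t(2) v by (auto simp: S_def)
    ultimately have "\<exists>m\<in>S. \<forall>m'\<in>S. m' \<noteq> m \<longrightarrow> grevlex_less m' m"
      by (rule grevlex_max_exists)
    then obtain m where m: "m \<in> S" "\<And>m'. m' \<in> S \<Longrightarrow> m' \<noteq> m \<Longrightarrow> grevlex_less m' m"
      by (elim bexE) simp
    then have mL: "m \<in> L" "w m \<in> t" "u (w m) \<noteq> 0"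
      by (auto simp: S_def)
    have "u v * lookup v m = 0" if vt: "v \<in> t - {w m}" for v
    proof (cases "u v = 0")
      case False
      obtain m' where m': "m' \<in> L" "v = w m'"
        using t(2) vt by blast
      then have ne: "m' \<noteq> m" and "m' \<in> S"
        using vt False by (auto simp: S_def)
      then have "grevlex_less m' m"
        using m(2) by simp
      then have "\<not> grevlex_less m m'"
        by (rule grevlex_asym)
      then have "m \<notin> keys v"
        using w(2)[OF m'(1)] ne unfolding is_lead_mon_def m'(2) by auto
      then show ?thesis
        by (simp add: in_keys_iff)
    qed simp
    then have "(\<Sum>v\<in>t - {w m}. u v * lookup v m) = 0"
      by (intro sum.neutral ballI)
    then have "(\<Sum>v\<in>t. u v * lookup v m) = u (w m) * lookup (w m) m"
      using mL(2) t(1) by (simp add: sum.remove[of t "w m"])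
    also have "(\<Sum>v\<in>t. u v * lookup v m) = lookup (\<Sum>v\<in>t. scale_poly (u v) v) m"
      by (simp add: lookup_sum)
    finally have "u (w m) * lookup (w m) m = 0"
      by (simp add: t(3))
    moreover have "lookup (w m) m \<noteq> 0"
      using w(2)[OF mL(1)] by (simp add: is_lead_mon_def in_keys_iff)
    ultimately show False
      using mL(3) by simp
  qed
  then have "finite (w ` L) \<and> card (w ` L) \<le> card Y"
    using Y w(1) by (intro mpv.independent_span_bound) auto
  then show ?thesis
    using \<open>inj_on w L\<close> by (simp add: card_image)
qed

text \<open>
  Division with remainder: subtracting multiples of the \<open>w m\<close>, and of single monomials where no
  \<open>w m\<close> is available, lowers the leading monomial.
\<close>

lemma homogeneous_in_span_lead_mons:
  fixes w :: "mon \<Rightarrow> (nat, 'a::field) mpoly"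
  assumes V: "finite V" and L: "L \<subseteq> monomials V k"
    and w: "\<And>m. m \<in> L \<Longrightarrow> w m \<in> graded_part k (poly_ring V)" "\<And>m. m \<in> L \<Longrightarrow> is_lead_mon (w m) m"
    and p: "p \<in> graded_part k (poly_ring V)"
  shows "p \<in> mpv.span (w ` L \<union> mono_poly ` (monomials V k - L))" (is "p \<in> mpv.span ?Y")
proof -
  let ?M = "monomials V k"
  define rank where "rank m = card {m' \<in> ?M. grevlex_less m' m}" for m
  have rank_less: "rank m < rank m'" if "m \<in> ?M" "grevlex_less m m'" for m m'
    unfolding rank_def
  proof (rule psubset_card_mono)
    show "finite {m'' \<in> ?M. grevlex_less m'' m'}"
      using finite_monomials[OF V] by simp
    show "{m' \<in> ?M. grevlex_less m' m} \<subset> {m'' \<in> ?M. grevlex_less m'' m'}"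
      using that grevlex_irrefl grevlex_trans by blast
  qed
  have R: "mpv.subspace (graded_part k (poly_ring V :: (nat, 'a) mpoly set))"
    by (rule subspace_graded_part[OF is_ideal_poly_ring])
  have keysM: "m \<in> ?M" if "m \<in> keys q" "q \<in> graded_part k (poly_ring V :: (nat, 'a) mpoly set)" for m q
    using that by (auto simp: graded_part_def poly_ring_def homogeneous_of_degree_def monomials_def)
  have "p \<in> mpv.span ?Y" if "p \<in> graded_part k (poly_ring V)" "\<forall>m\<in>keys p. rank m < r" for p r
    using that
  proof (induction r arbitrary: p)
    case 0
    then have "keys p = {}"
      by auto
    then have "p = 0"
      using lead_mon_exists[of p] by (auto simp: is_lead_mon_def)
    then show ?case
      by (simp add: mpv.span_zero)
  next
    case (Suc r)
    show ?case
    proof (cases "p = 0")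
      case False
      then obtain m where m: "is_lead_mon p m"
        using lead_mon_exists by blast
      then have mp: "m \<in> keys p" "m \<in> ?M"
        using keysM[OF _ Suc.prems(1)] by (auto simp: is_lead_mon_def)
      define v where "v = (if m \<in> L then w m else mono_poly m)"
      have v: "v \<in> ?Y" "v \<in> graded_part k (poly_ring V)" "is_lead_mon v m"
        using w mp(2) by (auto simp: v_def lead_mon_mono_poly graded_part_def poly_ring_mono_poly
            homogeneous_mono_poly monomials_def)
      define c where "c = lookup p m / lookup v m"
      define q where "q = p - scale_poly c v"
      have "lookup v m \<noteq> 0"
        using v(3) by (simp add: is_lead_mon_def in_keys_iff)
      then have q0: "lookup q m = 0"
        by (simp add: q_def lookup_minus c_def)
      have qR: "q \<in> graded_part k (poly_ring V)"
        unfolding q_def using mpv.subspace_diff[OF R] mpv.subspace_scale[OF R] Suc.prems(1) v(2) by blast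
      have "rank m' < r" if m': "m' \<in> keys q" for m'
      proof -
        have "lookup p m' \<noteq> 0 \<or> lookup v m' \<noteq> 0" "m' \<noteq> m"
          using m' q0 by (auto simp: in_keys_iff q_def lookup_minus)
        then have "grevlex_less m' m"
          using m v(3) by (auto simp: is_lead_mon_def in_keys_iff)
        then have "rank m' < rank m"
          using rank_less keysM[OF m' qR] by blast
        also have "rank m \<le> r"
          using Suc.prems(2) mp(1) less_Suc_eq_le by blast
        finally show ?thesis
          by simp
      qed
      then have "q \<in> mpv.span ?Y"
        using Suc.IH[OF qR] by blast
      then have "q + scale_poly c v \<in> mpv.span ?Y"
        using v(1) by (intro mpv.span_add mpv.span_scale) (auto intro: mpv.span_base)
      then show ?thesis
        by (simp add: q_def)
    qed (simp add: mpv.span_zero)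
  qed
  from this[OF p, of "Suc (Max (rank ` keys p))"] show ?thesis
    by (auto simp: less_Suc_eq_le)
qed

lemma span_mono_poly_keys:
  assumes "p \<in> mpv.span (mono_poly ` T)"
  shows "keys p \<subseteq> T"
  using assms
proof (induction rule: mpv.span_induct_alt)
  case (step c x y)
  then show ?case
    using keys_add[of "scale_poly c x" y] keys_scale_poly[of c x] by fastforce
qed simp

text \<open>
  Consequently the leading monomials of degree \<open>k\<close> of a homogeneous ideal count the dimension of
  its component of degree \<open>k\<close>, and the other monomials of degree \<open>k\<close> the codimension: choose one
  polynomial for each leading monomial and divide. A remainder that lies in the ideal vanishes,
  since its leading monomial would have been divided out.
\<close>

lemma graded_part_basis:
  fixes A :: "(nat, 'a::field) mpoly set"
  assumes V: "finite V" and A: "A \<subseteq> poly_ring V" "homogeneous_set A"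
  defines "I \<equiv> ideal_gen V A"
  shows "\<exists>w. w ` lead_mons k I \<subseteq> graded_part k I \<and> graded_part k I \<subseteq> mpv.span (w ` lead_mons k I) \<and>
    graded_part k (poly_ring V) \<subseteq>
      mpv.span (w ` lead_mons k I \<union> mono_poly ` (monomials V k - lead_mons k I))"
proof -
  let ?L = "lead_mons k I" and ?M = "monomials V k"
  have I: "is_ideal V I"
    unfolding I_def by (rule is_ideal_ideal_gen[OF A(1)])
  have L: "?L \<subseteq> ?M"
    by (rule lead_mons_subset_monomials[OF is_ideal_subset[OF I]])
  have "\<forall>m\<in>?L. \<exists>p. p \<in> graded_part k I \<and> is_lead_mon p m"
    unfolding I_def using lead_mons_homogeneousE[OF A] by metis
  then obtain w where w: "\<And>m. m \<in> ?L \<Longrightarrow> w m \<in> graded_part k I" "\<And>m. m \<in> ?L \<Longrightarrow> is_lead_mon (w m) m"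
    by metis
  have sub: "graded_part k I \<subseteq> graded_part k (poly_ring V)"
    using is_ideal_subset[OF I] by (auto simp: graded_part_def)
  have all: "p \<in> mpv.span (w ` ?L \<union> mono_poly ` (?M - ?L))" if "p \<in> graded_part k (poly_ring V)" for p
    using w sub that by (intro homogeneous_in_span_lead_mons[OF V L]) auto
  have "p \<in> mpv.span (w ` ?L)" if p: "p \<in> graded_part k I" for p
  proof -
    from all[of p] p sub obtain a b where ab: "p = a + b" "a \<in> mpv.span (w ` ?L)"
      "b \<in> mpv.span (mono_poly ` (?M - ?L))"
      unfolding mpv.span_Un by blast
    have "w ` ?L \<subseteq> graded_part k I"
      using w(1) by blast
    then have "a \<in> graded_part k I"
      using mpv.span_minimal[OF _ subspace_graded_part[OF I]] ab(2) by blast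
    then have "p - a \<in> graded_part k I"
      using mpv.subspace_diff[OF subspace_graded_part[OF I]] p by blast
    then have b: "b \<in> graded_part k I"
      by (simp add: ab(1))
    have "b = 0"
    proof (rule ccontr)
      assume "b \<noteq> 0"
      then obtain m where m: "is_lead_mon b m"
        using lead_mon_exists by blast
      then have "m \<in> ?L"
        using b by (auto simp: lead_mons_def graded_part_def is_lead_mon_def homogeneous_of_degree_def)
      moreover have "m \<in> ?M - ?L"
        using m span_mono_poly_keys[OF ab(3)] by (auto simp: is_lead_mon_def)
      ultimately show False
        by blast
    qed
    then show ?thesis
      using ab by simp
  qed
  then show ?thesis
    using w(1) all by (intro exI[of _ w]) blast
qed

lemma finite_lead_mons:
  assumes "finite V" "J \<subseteq> poly_ring V"
  shows "finite (lead_mons k J)"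
  using finite_subset[OF lead_mons_subset_monomials[OF assms(2)] finite_monomials[OF assms(1)]] .

lemma mon_degree_eq_0_iff: "mon_degree m = 0 \<longleftrightarrow> m = 0"
proof
  assume "mon_degree m = 0"
  then show "m = 0"
    using lookup_le_mon_degree[of m] by (intro poly_mapping_eqI) simp
qed simp

lemma homogeneous_0_eq_single:
  assumes "homogeneous_of_degree 0 p"
  shows "p = single 0 (lookup p 0)"
proof (rule poly_mapping_eqI)
  fix m show "lookup p m = lookup (single 0 (lookup p 0)) m"
    using assms
    by (cases "m = 0") (auto simp: homogeneous_of_degree_def mon_degree_eq_0_iff in_keys_iff
        lookup_single)
qed

text \<open>
  Taking components of degree \<open>k\<close> makes the coefficient of the new generator homogeneous.
\<close>

lemma ideal_gen_insert_homogeneousE: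
  fixes A :: "(nat, 'a::comm_ring_1) mpoly set"
  assumes A: "A \<subseteq> poly_ring V" "homogeneous_set A"
    and g: "g \<in> poly_ring V" "homogeneous_of_degree d g"
    and p: "p \<in> graded_part k (ideal_gen V (insert g A))"
  obtains q r where "q \<in> graded_part k (ideal_gen V A)" "p = q + r * g"
    "if d \<le> k then r \<in> graded_part (k - d) (poly_ring V) else r = 0"
proof -
  obtain q r where qr: "q \<in> ideal_gen V A" "r \<in> poly_ring V" "p = q + r * g"
    using ideal_gen_insertE[OF A(1) g(1)] p unfolding graded_part_def by blast
  have "hom_component k q \<in> graded_part k (ideal_gen V A)"
    using hom_component_in_ideal_gen[OF A qr(1)] homogeneous_hom_component by (auto simp: graded_part_def)
  moreover have "p = hom_component k p"
    using p by (simp add: graded_part_def hom_component_homogeneous[of k])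
  then have "p = hom_component k q + (if d \<le> k then hom_component (k - d) r else 0) * g"
    by (simp add: qr(3) hom_component_add hom_component_mult_homogeneous[OF g(2)])
  moreover have "if d \<le> k then (if d \<le> k then hom_component (k - d) r else 0) \<in> graded_part (k - d) (poly_ring V)
      else (if d \<le> k then hom_component (k - d) r else 0) = 0"
    using qr(2) by (simp add: graded_part_def homogeneous_hom_component poly_ring_hom_component)
  ultimately show ?thesis
    using that by blast
qed

text \<open>
  The monomials in \<open>T\<close> and one polynomial for each leading monomial span the whole component of
  degree \<open>k\<close>, so they are at least as many as its monomials.
\<close>

lemma card_monomials_le:
  fixes A :: "(nat, 'a::field) mpoly set"
  assumes V: "finite V" and A: "A \<subseteq> poly_ring V" "homogeneous_set A" and T: "T \<subseteq> monomials V k"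
    and gen: "mono_poly ` monomials V k \<subseteq> ideal_gen V (A \<union> mono_poly ` T)"
  shows "card (monomials V k) \<le> card (lead_mons k (ideal_gen V A)) + card T"
proof -
  let ?M = "monomials V k" and ?I = "ideal_gen V A"
  have mono_hom: "homogeneous_set (mono_poly ` T' :: (nat, 'a) mpoly set)" for T'
    using homogeneous_mono_poly unfolding homogeneous_set_def by blast
  have fin: "finite ?M" "finite T"
    using finite_monomials[OF V] T finite_subset by auto
  have *: "\<exists>q\<in>graded_part k ?I. p - q \<in> mpv.span (mono_poly ` T)"
    if "p \<in> graded_part k (ideal_gen V (A \<union> mono_poly ` T))" for p
    using fin(2) T that
  proof (induction T arbitrary: p rule: finite_induct)
    case empty
    then show ?case
      by (auto intro!: bexI[of _ p])
  next
    case (insert t T)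
    have A': "A \<union> mono_poly ` T \<subseteq> poly_ring V" "homogeneous_set (A \<union> mono_poly ` T)"
      using A insert.prems(1) mono_hom[of T] by (auto simp: monomials_def homogeneous_set_def
          intro!: poly_ring_mono_poly)
    have t: "mono_poly t \<in> poly_ring V" "homogeneous_of_degree k (mono_poly t :: (nat, 'a) mpoly)"
      using insert.prems(1) by (auto simp: monomials_def homogeneous_mono_poly intro!: poly_ring_mono_poly)
    have "p \<in> graded_part k (ideal_gen V (insert (mono_poly t) (A \<union> mono_poly ` T)))"
      using insert.prems(2) by simp
    then obtain q r where q: "q \<in> graded_part k (ideal_gen V (A \<union> mono_poly ` T))" "p = q + r * mono_poly t"
      and r: "r \<in> graded_part (k - k) (poly_ring V)"
      using ideal_gen_insert_homogeneousE[OF A' t, of p k] by auto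
    obtain q' where q': "q' \<in> graded_part k ?I" "q - q' \<in> mpv.span (mono_poly ` T)"
      using insert.IH[OF _ q(1)] insert.prems(1) by blast
    have "r = single 0 (lookup r 0)"
      using r by (intro homogeneous_0_eq_single) (simp add: graded_part_def)
    then have "r * mono_poly t = scale_poly (lookup r 0) (mono_poly t)"
      by (metis scale_poly_def)
    then have "p - q' = (q - q') + scale_poly (lookup r 0) (mono_poly t)"
      using q(2) by simp
    also have "\<dots> \<in> mpv.span (mono_poly ` insert t T)"
    proof (rule mpv.span_add[OF _ mpv.span_scale[OF mpv.span_base]])
      show "q - q' \<in> mpv.span (mono_poly ` insert t T)"
        using q'(2) mpv.span_mono[of "mono_poly ` T" "mono_poly ` insert t T"] by blast
    qed simp
    finally show ?case
      using q'(1) by blast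
  qed
  let ?L = "lead_mons k ?I"
  from graded_part_basis[OF V A, of k] obtain w where w: "graded_part k ?I \<subseteq> mpv.span (w ` ?L)"
    by (elim exE conjE) (rule that)
  have finL: "finite ?L"
    using finite_lead_mons[OF V is_ideal_subset[OF is_ideal_ideal_gen[OF A(1)]]] .
  have "card ?M \<le> card (w ` ?L \<union> mono_poly ` T :: (nat, 'a) mpoly set)"
  proof (rule card_lead_mons_le)
    show "finite (w ` ?L \<union> mono_poly ` T :: (nat, 'a) mpoly set)"
      using finL fin(2) by simp
    fix m assume m: "m \<in> ?M"
    then have "mono_poly m \<in> graded_part k (ideal_gen V (A \<union> mono_poly ` T))"
      using gen by (auto simp: graded_part_def monomials_def homogeneous_mono_poly)
    then obtain q where q: "q \<in> graded_part k ?I" "mono_poly m - q \<in> mpv.span (mono_poly ` T)"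
      using * by blast
    then have "q + (mono_poly m - q) \<in> mpv.span (w ` ?L \<union> mono_poly ` T)"
      using w unfolding mpv.span_Un by blast
    then have "mono_poly m \<in> mpv.span (w ` ?L \<union> mono_poly ` T)"
      by simp
    then show "\<exists>p\<in>mpv.span (w ` ?L \<union> mono_poly ` T). is_lead_mon p m"
      using lead_mon_mono_poly by blast
  qed
  also have "\<dots> \<le> card (w ` ?L) + card (mono_poly ` T :: (nat, 'a) mpoly set)"
    by (rule card_Un_le)
  also have "\<dots> \<le> card ?L + card T"
    using finL fin(2) by (intro add_mono card_image_le)
  finally show ?thesis .
qed

text \<open>
  Adding a generator \<open>g\<close> of degree \<open>d\<close> enlarges the component of degree \<open>k\<close> by at most the image of
  multiplication by \<open>g\<close> on the residue classes of degree \<open>k - d\<close>.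
\<close>

lemma card_lead_mons_insert_le:
  fixes A :: "(nat, 'a::field) mpoly set"
  assumes V: "finite V" and A: "A \<subseteq> poly_ring V" "homogeneous_set A"
    and g: "g \<in> poly_ring V" "homogeneous_of_degree d g"
  shows "card (lead_mons k (ideal_gen V (insert g A))) \<le> card (lead_mons k (ideal_gen V A)) +
    (if d \<le> k then card (monomials V (k - d) - lead_mons (k - d) (ideal_gen V A)) else 0)"
proof -
  let ?I = "ideal_gen V A" and ?J = "ideal_gen V (insert g A)"
  note I = is_ideal_ideal_gen[OF A(1)]
  let ?L = "lead_mons k ?I" and ?L' = "lead_mons (k - d) ?I"
  define C where "C = (if d \<le> k then monomials V (k - d) - ?L' else {})"
  have A': "insert g A \<subseteq> poly_ring V" "homogeneous_set (insert g A)"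
    using A g by (auto simp: homogeneous_set_def)
  from graded_part_basis[OF V A, of k] obtain w where w: "graded_part k ?I \<subseteq> mpv.span (w ` ?L)"
    by (elim exE conjE) (rule that)
  obtain w' where w': "w' ` ?L' \<subseteq> graded_part (k - d) ?I"
    "graded_part (k - d) (poly_ring V) \<subseteq> mpv.span (w' ` ?L' \<union> mono_poly ` (monomials V (k - d) - ?L'))"
    using graded_part_basis[OF V A, of "k - d"] by (elim exE conjE) (rule that)
  let ?Y = "w ` ?L \<union> (\<lambda>m. mono_poly m * g) ` C"
  have fin: "finite ?L" "finite C"
    using finite_lead_mons[OF V is_ideal_subset[OF I]] finite_monomials[OF V] by (auto simp: C_def)
  have mult_g: "r * g \<in> mpv.span ?Y" if "d \<le> k" "r \<in> graded_part (k - d) (poly_ring V)" for r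
  proof -
    have "r \<in> mpv.span (w' ` ?L' \<union> mono_poly ` (monomials V (k - d) - ?L'))"
      using w'(2) that(2) by blast
    then show ?thesis
    proof (induction rule: mpv.span_induct_alt)
      case base
      then show ?case
        by (simp add: mpv.span_zero)
    next
      case (step c x y)
      have "x * g \<in> mpv.span ?Y"
        using step(1)
      proof
        assume "x \<in> w' ` ?L'"
        then have x: "x \<in> graded_part (k - d) ?I"
          using w'(1) by blast
        have "homogeneous_of_degree (k - d + d) (x * g)"
          using x g(2) by (intro homogeneous_mult) (simp_all add: graded_part_def)
        moreover have "g * x \<in> ?I"
          using x g(1) by (intro is_ideal_mult[OF I]) (simp_all add: graded_part_def)
        ultimately have "x * g \<in> graded_part k ?I"
          using that(1) by (simp add: graded_part_def mult.commute)
        then show ?thesis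
          using w mpv.span_mono[of "w ` ?L" ?Y] by blast
      next
        assume "x \<in> mono_poly ` (monomials V (k - d) - ?L')"
        then have "x * g \<in> ?Y"
          using that(1) by (auto simp: C_def)
        then show ?thesis
          by (rule mpv.span_base)
      qed
      then have "scale_poly c (x * g) + y * g \<in> mpv.span ?Y"
        using step(2) by (intro mpv.span_add mpv.span_scale)
      moreover have "(scale_poly c x + y) * g = scale_poly c (x * g) + y * g"
        by (simp add: scale_poly_def algebra_simps)
      ultimately show ?case
        by simp
    qed
  qed
  have "card (lead_mons k ?J) \<le> card ?Y"
  proof (rule card_lead_mons_le)
    show "finite ?Y"
      using fin by simp
    fix m assume "m \<in> lead_mons k ?J"
    then obtain p where p: "p \<in> graded_part k ?J" "is_lead_mon p m"
      using lead_mons_homogeneousE[OF A'] by blast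
    obtain q r where qr: "q \<in> graded_part k ?I" "p = q + r * g"
      "if d \<le> k then r \<in> graded_part (k - d) (poly_ring V) else r = 0"
      using ideal_gen_insert_homogeneousE[OF A g p(1)] by blast
    have "q \<in> mpv.span ?Y"
      using w qr(1) mpv.span_mono[of "w ` ?L" ?Y] by blast
    moreover have "r * g \<in> mpv.span ?Y"
      using qr(3) mult_g mpv.span_zero by (cases "d \<le> k") auto
    ultimately show "\<exists>p\<in>mpv.span ?Y. is_lead_mon p m"
      using p(2) qr(2) mpv.span_add by blast
  qed
  also have "\<dots> \<le> card (w ` ?L) + card ((\<lambda>m. mono_poly m * g) ` C)"
    by (rule card_Un_le)
  also have "\<dots> \<le> card ?L + card C"
    using fin by (intro add_mono card_image_le)
  finally show ?thesis
    by (simp add: C_def split: if_splits)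
qed

text \<open>
  Adjoining a power \<open>z ^ c\<close> of the last variable only creates new leading monomials that are
  divisible by it: in one degree, all multiples of \<open>z ^ c\<close> are smaller than all other monomials.
\<close>

lemma lead_mon_without_last_power:
  fixes A :: "(nat, 'a::comm_ring_1) mpoly set"
  assumes A: "A \<subseteq> poly_ring {..n}" "homogeneous_set A"
    and p: "p \<in> graded_part k (ideal_gen {..n} (insert (mono_poly (single n c)) A))"
    and m: "is_lead_mon p m" "lookup m n < c"
  shows "m \<in> lead_mons k (ideal_gen {..n} A)"
proof -
  let ?z = "mono_poly (single n c) :: (nat, 'a) mpoly"
  have z: "?z \<in> poly_ring {..n}" "homogeneous_of_degree c ?z"
    by (auto intro!: poly_ring_mono_poly homogeneous_mono_poly split: if_splits)
  obtain q r where q: "q \<in> graded_part k (ideal_gen {..n} A)" and p_eq: "p = q + r * ?z"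
    using ideal_gen_insert_homogeneousE[OF A z p] by blast
  have A': "insert ?z A \<subseteq> poly_ring {..n}"
    using A z by blast
  have pM: "m' \<in> monomials {..n} k" if "m' \<in> keys p" for m'
    using that p is_ideal_subset[OF is_ideal_ideal_gen[OF A']]
    by (auto simp: graded_part_def poly_ring_def homogeneous_of_degree_def monomials_def)
  have qM: "m' \<in> monomials {..n} k" if "m' \<in> keys q" for m'
    using that q is_ideal_subset[OF is_ideal_ideal_gen[OF A(1)]]
    by (auto simp: graded_part_def poly_ring_def homogeneous_of_degree_def monomials_def)
  have zkeys: "c \<le> lookup m' n" if "m' \<in> keys (r * ?z)" for m'
    using keys_mult[of r ?z] that by (auto simp: lookup_add)
  have mp: "m \<in> keys p"
    using m(1) by (simp add: is_lead_mon_def)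
  have "m \<notin> keys (r * ?z)"
    using zkeys m(2) by fastforce
  then have "m \<in> keys q"
    using mp by (simp add: p_eq in_keys_iff lookup_add)
  moreover have "grevlex_less m' m" if m': "m' \<in> keys q" "m' \<noteq> m" for m'
  proof (cases "m' \<in> keys p")
    case True
    then show ?thesis
      using m(1) m'(2) by (simp add: is_lead_mon_def)
  next
    case False
    then have "m' \<in> keys (r * ?z)"
      using m'(1) by (auto simp: p_eq in_keys_iff lookup_add)
    then have "lookup m' n > lookup m n"
      using zkeys m(2) by fastforce
    then show ?thesis
      by (rule grevlex_less_last[OF qM[OF m'(1)] pM[OF mp]])
  qed
  ultimately have "is_lead_mon q m"
    by (simp add: is_lead_mon_def)
  moreover have "mon_degree m = k"
    using pM[OF mp] by (simp add: monomials_def)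
  ultimately show ?thesis
    using q by (auto simp: lead_mons_def graded_part_def)
qed

section \<open>Monomial ideals and initial ideals\<close>

text \<open>
  Polynomials all of whose monomials are divisible by one of the generators form an ideal.
\<close>

lemma keys_ideal_gen_mono_poly:
  fixes p :: "(nat, 'a::comm_ring_1) mpoly"
  assumes "\<And>a. a \<in> A \<Longrightarrow> keys a \<subseteq> V" "p \<in> ideal_gen V (mono_poly ` A)" "m \<in> keys p"
  obtains a b where "a \<in> A" "keys b \<subseteq> V" "m = b + a"
proof -
  let ?J = "{p :: (nat, 'a) mpoly. \<forall>m\<in>keys p. \<exists>a\<in>A. \<exists>b. keys b \<subseteq> V \<and> m = b + a}"
  have "is_ideal V ?J"
  proof (rule is_idealI)
    show "?J \<subseteq> poly_ring V"
      using assms(1) by (fastforce simp: poly_ring_def keys_add_mon)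
    show "p + q \<in> ?J" if "p \<in> ?J" "q \<in> ?J" for p q
      using keys_add[of p q] that by blast
    show "single a c * p \<in> ?J" if a: "keys a \<subseteq> V" and p: "p \<in> ?J" for a c p
    proof (rule CollectI, rule ballI)
      fix m assume "m \<in> keys (single a c * p)"
      then obtain m' where "m' \<in> keys p" "m = a + m'"
        using keys_single_mult by blast
      then obtain a' b where "a' \<in> A" "keys b \<subseteq> V" "m = (a + b) + a'"
        using p by (auto simp: add.assoc)
      then show "\<exists>a\<in>A. \<exists>b. keys b \<subseteq> V \<and> m = b + a"
        using a by (metis Un_least keys_add_mon)
    qed
  qed simp
  moreover have "mono_poly ` A \<subseteq> ?J"
    by (auto intro!: bexI exI[of _ 0])
  ultimately have "p \<in> ?J"
    using ideal_gen_minimal assms(2) by blast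
  then show ?thesis
    using assms(3) that by blast
qed

lemma initial_ideal_eq: "initial_ideal V J = ideal_gen V (mono_poly ` {m. \<exists>p\<in>J. is_lead_mon p m})"
  by (simp add: initial_ideal_def setcompr_eq_image)

text \<open>
  The leading monomials of an ideal are closed under multiples, so the initial ideal contains no
  further monomials.
\<close>

lemma mono_poly_in_initial_ideal_iff:
  fixes J :: "(nat, 'a::field) mpoly set"
  assumes J: "is_ideal V J"
  shows "mono_poly m \<in> initial_ideal V J \<longleftrightarrow> (\<exists>p\<in>J. is_lead_mon p m)"
proof
  assume *: "mono_poly m \<in> initial_ideal V J"
  have "keys a \<subseteq> V" if "a \<in> {m. \<exists>p\<in>J. is_lead_mon p m}" for a
    using that is_ideal_subset[OF J] by (auto simp: is_lead_mon_def poly_ring_def)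
  then obtain a b where "a \<in> {m. \<exists>p\<in>J. is_lead_mon p m}" "keys b \<subseteq> V" "m = b + a"
    by (rule keys_ideal_gen_mono_poly[OF _ *[unfolded initial_ideal_eq], of m]) simp_all
  then obtain p where "p \<in> J" "is_lead_mon (mono_poly b * p) m" "keys b \<subseteq> V"
    using lead_mon_mult[OF lead_mon_mono_poly[of b]] by blast
  then show "\<exists>p\<in>J. is_lead_mon p m"
    using is_ideal_mult[OF J poly_ring_mono_poly] by blast
next
  assume "\<exists>p\<in>J. is_lead_mon p m"
  then have "mono_poly m \<in> mono_poly ` {m. \<exists>p\<in>J. is_lead_mon p m}"
    by simp
  then show "mono_poly m \<in> initial_ideal V J"
    unfolding initial_ideal_eq by (rule subsetD[OF ideal_gen_superset])
qed

lemma is_ideal_initial_ideal: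
  fixes J :: "(nat, 'a::comm_ring_1) mpoly set"
  assumes "is_ideal V J"
  shows "is_ideal V (initial_ideal V J)"
  unfolding initial_ideal_eq
proof (rule is_ideal_ideal_gen)
  have "keys m \<subseteq> V" if "p \<in> J" "is_lead_mon p m" for p m
    using that is_ideal_subset[OF assms] by (auto simp: is_lead_mon_def poly_ring_def)
  then show "mono_poly ` {m. \<exists>p\<in>J. is_lead_mon p m} \<subseteq> poly_ring V"
    by (auto intro!: poly_ring_mono_poly)
qed

section \<open>Generic coefficients\<close>

definition mon_eval :: "('i \<Rightarrow> 'a::comm_ring_1) \<Rightarrow> ('i \<Rightarrow>\<^sub>0 nat) \<Rightarrow> 'a" where
  "mon_eval c m = (\<Prod>i\<in>keys m. c i ^ lookup m i)"

lemma mon_eval_superset: "finite A \<Longrightarrow> keys m \<subseteq> A \<Longrightarrow> mon_eval c m = (\<Prod>i\<in>A. c i ^ lookup m i)"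
  unfolding mon_eval_def by (intro prod.mono_neutral_left) (auto simp: in_keys_iff)

lemma mon_eval_add: "mon_eval c (a + b) = mon_eval c a * mon_eval c b"
proof -
  have "mon_eval c m = (\<Prod>i\<in>keys a \<union> keys b. c i ^ lookup m i)" if "keys m \<subseteq> keys a \<union> keys b" for m
    using that by (intro mon_eval_superset) auto
  then show ?thesis
    by (simp add: keys_add_mon lookup_add power_add prod.distrib)
qed

lemma mpoly_eval_superset:
  "finite A \<Longrightarrow> keys P \<subseteq> A \<Longrightarrow> mpoly_eval c P = (\<Sum>m\<in>A. lookup P m * mon_eval c m)"
  unfolding mpoly_eval_def mon_eval_def by (intro sum.mono_neutral_left) (auto simp: in_keys_iff)

lemma mpoly_eval_zero [simp]: "mpoly_eval c 0 = 0"
  by (simp add: mpoly_eval_def)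

lemma mpoly_eval_add: "mpoly_eval c (P + Q) = mpoly_eval c P + mpoly_eval c Q"
proof -
  have "mpoly_eval c R = (\<Sum>m\<in>keys P \<union> keys Q. lookup R m * mon_eval c m)"
    if "keys R \<subseteq> keys P \<union> keys Q" for R
    using that by (intro mpoly_eval_superset) auto
  then show ?thesis
    using keys_add[of P Q] by (simp add: lookup_add ring_distribs sum.distrib)
qed

lemma mpoly_eval_sum: "mpoly_eval c (sum f A) = (\<Sum>x\<in>A. mpoly_eval c (f x))"
  by (induction A rule: infinite_finite_induct) (simp_all add: mpoly_eval_add)

lemma mpoly_eval_single: "mpoly_eval c (single m a) = a * mon_eval c m"
  using mpoly_eval_superset[of "{m}" "single m a" c] by simp

lemma mult_eq_sum_singles:
  fixes P Q :: "('i, 'a::comm_ring_1) mpoly"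
  shows "P * Q = (\<Sum>a\<in>keys P. \<Sum>b\<in>keys Q. single (a + b) (lookup P a * lookup Q b))"
  by (subst poly_eq_sum_singles[of P], subst poly_eq_sum_singles[of Q])
    (simp add: sum_product mult_single)

lemma mpoly_eval_mult: "mpoly_eval c (P * Q) = mpoly_eval c P * mpoly_eval c Q"
proof -
  have "mpoly_eval c (P * Q) =
      (\<Sum>a\<in>keys P. \<Sum>b\<in>keys Q. (lookup P a * mon_eval c a) * (lookup Q b * mon_eval c b))"
    by (simp add: mult_eq_sum_singles mpoly_eval_sum mpoly_eval_single mon_eval_add ac_simps)
  then show ?thesis
    by (simp add: mpoly_eval_def mon_eval_def sum_product)
qed

text \<open>
  Only closure properties of this class of functions are used, so a determinant with such entries
  need not be written as a polynomial.
\<close>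

definition poly_function :: "'a::field set \<Rightarrow> 'i set \<Rightarrow> (('i \<Rightarrow> 'a) \<Rightarrow> 'a) \<Rightarrow> bool" where
  "poly_function F X \<phi> \<longleftrightarrow>
     (\<exists>P\<in>poly_ring X. (\<forall>m. lookup P m \<in> F) \<and> (\<forall>c. mpoly_eval c P = \<phi> c))"

text \<open>
  Algebraically independent elements are a generic point: a polynomial function that is nonzero
  somewhere is nonzero there. The other point may have coordinates outside of \<open>F\<close>.
\<close>

lemma alg_independent_nonzero:
  assumes "alg_independent F X c" "poly_function F X \<phi>" "\<phi> c' \<noteq> 0"
  shows "\<phi> c \<noteq> 0"
proof -
  obtain P where P: "P \<in> poly_ring X" "\<forall>m. lookup P m \<in> F" "\<And>c. mpoly_eval c P = \<phi> c"
    using assms(2) unfolding poly_function_def by blast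
  have "P \<noteq> 0"
    using P(3)[of c'] assms(3) by auto
  then have "mpoly_eval c P \<noteq> 0"
    using assms(1) P(1,2) unfolding alg_independent_def by blast
  then show ?thesis
    by (simp add: P(3))
qed

lemma is_subfield_zero: "is_subfield F \<Longrightarrow> 0 \<in> F"
  and is_subfield_one: "is_subfield F \<Longrightarrow> 1 \<in> F"
  and is_subfield_mult: "is_subfield F \<Longrightarrow> a \<in> F \<Longrightarrow> b \<in> F \<Longrightarrow> a * b \<in> F"
  and is_subfield_diff: "is_subfield F \<Longrightarrow> a \<in> F \<Longrightarrow> b \<in> F \<Longrightarrow> a - b \<in> F"
  by (simp_all add: is_subfield_def)

lemma is_subfield_uminus: "is_subfield F \<Longrightarrow> a \<in> F \<Longrightarrow> - a \<in> F"
  using is_subfield_diff[of F 0 a] is_subfield_zero[of F] by simp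

lemma is_subfield_add: "is_subfield F \<Longrightarrow> a \<in> F \<Longrightarrow> b \<in> F \<Longrightarrow> a + b \<in> F"
  using is_subfield_diff[of F a "- b"] is_subfield_uminus[of F b] by simp

lemma is_subfield_sum: "is_subfield F \<Longrightarrow> (\<And>x. x \<in> A \<Longrightarrow> f x \<in> F) \<Longrightarrow> sum f A \<in> F"
  by (induction A rule: infinite_finite_induct) (simp_all add: is_subfield_zero is_subfield_add)

lemma poly_function_const:
  assumes "is_subfield F" "a \<in> F"
  shows "poly_function F X (\<lambda>c. a)"
  unfolding poly_function_def using assms is_subfield_zero
  by (intro bexI[of _ "single 0 a"])
    (auto simp: mpoly_eval_single mon_eval_def lookup_single when_def poly_ring_def)

lemma poly_function_var:
  assumes "is_subfield F" "i \<in> X"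
  shows "poly_function F X (\<lambda>c. c i)"
  unfolding poly_function_def using assms is_subfield_zero is_subfield_one
  by (intro bexI[of _ "single (single i 1) 1"])
    (auto simp: mpoly_eval_single mon_eval_def lookup_single when_def poly_ring_def)

lemma poly_function_add:
  assumes "is_subfield F" "poly_function F X \<phi>" "poly_function F X \<psi>"
  shows "poly_function F X (\<lambda>c. \<phi> c + \<psi> c)"
proof -
  obtain P Q where P: "P \<in> poly_ring X" "\<forall>m. lookup P m \<in> F" "\<forall>c. mpoly_eval c P = \<phi> c"
    and Q: "Q \<in> poly_ring X" "\<forall>m. lookup Q m \<in> F" "\<forall>c. mpoly_eval c Q = \<psi> c"
    using assms(2,3) unfolding poly_function_def by (elim bexE conjE)
  have "P + Q \<in> poly_ring X"
    using P(1) Q(1) by (rule poly_ring_add)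
  then show ?thesis
    unfolding poly_function_def using P Q is_subfield_add[OF assms(1)]
    by (intro bexI[of _ "P + Q"]) (auto simp: mpoly_eval_add lookup_add)
qed

lemma poly_function_mult:
  assumes F: "is_subfield F" and "poly_function F X \<phi>" "poly_function F X \<psi>"
  shows "poly_function F X (\<lambda>c. \<phi> c * \<psi> c)"
proof -
  obtain P Q where P: "P \<in> poly_ring X" "\<forall>m. lookup P m \<in> F" "\<forall>c. mpoly_eval c P = \<phi> c"
    and Q: "Q \<in> poly_ring X" "\<forall>m. lookup Q m \<in> F" "\<forall>c. mpoly_eval c Q = \<psi> c"
    using assms(2,3) unfolding poly_function_def by (elim bexE conjE)
  have "P * Q \<in> poly_ring X"
    using P(1) Q(1) by (rule poly_ring_mult)
  moreover have "lookup (P * Q) m \<in> F" for m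
    unfolding mult_eq_sum_singles lookup_sum lookup_single when_def
    using P(2) Q(2) F by (intro is_subfield_sum[OF F]) (simp add: is_subfield_mult is_subfield_zero)
  ultimately show ?thesis
    unfolding poly_function_def using P(3) Q(3)
    by (intro bexI[of _ "P * Q"]) (auto simp: mpoly_eval_mult)
qed

lemma poly_function_sum:
  assumes "is_subfield F" "\<And>x. x \<in> A \<Longrightarrow> poly_function F X (\<phi> x)"
  shows "poly_function F X (\<lambda>c. \<Sum>x\<in>A. \<phi> x c)"
  using assms(2)
  by (induction A rule: infinite_finite_induct)
    (simp_all add: poly_function_const poly_function_add assms(1) is_subfield_zero)

lemma poly_function_prod:
  assumes "is_subfield F" "\<And>x. x \<in> A \<Longrightarrow> poly_function F X (\<phi> x)"
  shows "poly_function F X (\<lambda>c. \<Prod>x\<in>A. \<phi> x c)"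
  using assms(2)
  by (induction A rule: infinite_finite_induct)
    (simp_all add: poly_function_const poly_function_mult assms(1) is_subfield_one)

lemma poly_function_det:
  assumes F: "is_subfield F" and "\<And>i j. i < N \<Longrightarrow> j < N \<Longrightarrow> poly_function F X (\<phi> i j)"
  shows "poly_function F X (\<lambda>c. det (mat N N (\<lambda>(i, j). \<phi> i j c)))"
proof -
  have "(signof p :: 'a) \<in> F" for p :: "nat \<Rightarrow> nat"
    using is_subfield_one[OF F] is_subfield_uminus[OF F] by (simp add: sign_def)
  moreover have "det (mat N N (\<lambda>(i, j). \<phi> i j c)) =
      (\<Sum>p\<in>{p. p permutes {0..<N}}. signof p * (\<Prod>i\<in>{0..<N}. \<phi> i (p i) c))" for c
    unfolding det_def'[OF mat_carrier]
    by (intro sum.cong refl arg_cong2[of _ _ _ _ "(*)"] prod.cong) (auto simp: permutes_in_image)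
  ultimately show ?thesis
    using assms
    by (auto intro!: poly_function_sum poly_function_mult poly_function_prod poly_function_const
        simp: permutes_in_image)
qed

lemma adj_mat_mult_entry:
  assumes A: "A \<in> carrier_mat N N" and ij: "i < N" "j < N"
  shows "(\<Sum>l\<in>{0..<N}. adj_mat A $$ (i, l) * A $$ (l, j)) = (if i = j then det A else 0)"
proof -
  have dims: "dim_row (adj_mat A) = N" "dim_col (adj_mat A) = N" "dim_row A = N" "dim_col A = N"
    using adj_mat(1)[OF A] A by auto
  have "(adj_mat A * A) $$ (i, j) = row (adj_mat A) i \<bullet> col A j"
    using ij dims by simp
  also have "\<dots> = (\<Sum>l\<in>{0..<N}. adj_mat A $$ (i, l) * A $$ (l, j))"
    using ij dims by (simp add: scalar_prod_def)
  finally show ?thesis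
    using ij unfolding adj_mat(3)[OF A] by (cases "i = j") simp_all
qed

text \<open>
  A term times a multiple of a generator by a monomial is again such a multiple, up to a scalar, and
  the degrees add up. So the polynomials with all components in the spans of these multiples form an
  ideal.
\<close>

lemma graded_part_ideal_gen_subset_span:
  fixes A :: "(nat, 'a::field) mpoly set"
  assumes A: "A \<subseteq> poly_ring V" "homogeneous_set A"
  shows "graded_part k (ideal_gen V A) \<subseteq>
    mpv.span {mono_poly a * h | a h. keys a \<subseteq> V \<and> h \<in> A \<and> homogeneous_of_degree k (mono_poly a * h)}"
proof -
  define Y where "Y k = {mono_poly a * h | a h. keys a \<subseteq> V \<and> h \<in> A \<and>
    homogeneous_of_degree k (mono_poly a * h)}" for k
  have single_span: "single b c * y \<in> mpv.span (Y (mon_degree b + k))"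
    if b: "keys b \<subseteq> V" and "y \<in> mpv.span (Y k)" for b c y k
    using that(2)
  proof (induction rule: mpv.span_induct_alt)
    case base
    then show ?case
      by (simp add: mpv.span_zero)
  next
    case (step e x y)
    then obtain a h where x: "x = mono_poly a * h" "keys a \<subseteq> V" "h \<in> A"
        "homogeneous_of_degree k (mono_poly a * h)"
      by (auto simp: Y_def)
    have "homogeneous_of_degree (mon_degree b + k) (mono_poly b * (mono_poly a * h))"
      using x(4) by (intro homogeneous_mult) (auto simp: homogeneous_mono_poly)
    then have "mono_poly (b + a) * h \<in> Y (mon_degree b + k)"
      using x b by (auto simp: Y_def mono_poly_add mult.assoc keys_add_mon
          intro!: exI[of _ "b + a"] exI[of _ h])
    then have "scale_poly (c * e) (mono_poly (b + a) * h) + single b c * y \<in>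
        mpv.span (Y (mon_degree b + k))"
      using step by (intro mpv.span_add mpv.span_scale) (auto intro: mpv.span_base)
    moreover have "single b c * scale_poly e x = scale_poly (c * e) (mono_poly (b + a) * h)"
      by (simp add: x(1) scale_poly_def mono_poly_def mult_single flip: mult.assoc)
    ultimately show ?case
      by (simp add: ring_distribs)
  qed
  let ?J = "{p \<in> poly_ring V. \<forall>k. hom_component k p \<in> mpv.span (Y k)}"
  have "is_ideal V ?J"
  proof (rule is_idealI)
    show "single b c * p \<in> ?J" if b: "keys b \<subseteq> V" and p: "p \<in> ?J" for b c p
    proof -
      have "hom_component k (single b c * p) \<in> mpv.span (Y k)" for k
        using single_span[OF b, of "hom_component (k - mon_degree b) p" "k - mon_degree b" c] p
        by (auto simp: hom_component_single_mult mpv.span_zero)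
      then show ?thesis
        using b p by (simp add: poly_ring_mult poly_ring_single)
    qed
  qed (auto simp: mpv.span_zero hom_component_add poly_ring_add intro: mpv.span_add)
  moreover have "A \<subseteq> ?J"
  proof
    fix h assume h: "h \<in> A"
    have "hom_component k h \<in> mpv.span (Y k)" for k
    proof (cases "homogeneous_of_degree k h")
      case True
      then have "h \<in> Y k"
        using h by (auto simp: Y_def intro!: exI[of _ 0] exI[of _ h])
      then show ?thesis
        using True by (simp add: hom_component_homogeneous[of k] mpv.span_base)
    next
      case False
      obtain d where d: "homogeneous_of_degree d h"
        using A(2) h by (auto simp: homogeneous_set_def)
      then have "k \<noteq> d"
        using False by auto
      then show ?thesis
        by (simp add: hom_component_homogeneous[OF d] mpv.span_zero)
    qed
    then show "h \<in> ?J"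
      using A(1) h by blast
  qed
  ultimately have J: "ideal_gen V A \<subseteq> ?J"
    using ideal_gen_minimal by blast
  have "p \<in> mpv.span (Y k)" if "p \<in> graded_part k (ideal_gen V A)" for p
  proof -
    have "p \<in> ?J"
      using that J by (auto simp: graded_part_def)
    then have "hom_component k p \<in> mpv.span (Y k)"
      by simp
    then show ?thesis
      using that by (simp add: graded_part_def hom_component_homogeneous[of k])
  qed
  then show ?thesis
    unfolding Y_def by blast
qed

text \<open>
  A coefficient of \<open>a * h\<close> is zero or a coefficient of \<open>h\<close>, and which of them it is depends only on
  the degree of \<open>h\<close>. So one formula serves all polynomials of this degree at once.
\<close>

lemma lookup_single_mult_poly_ring:
  fixes h :: "(nat, 'a::comm_ring_1) mpoly"
  assumes "h \<in> poly_ring V" "homogeneous_of_degree e h"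
  shows "lookup (mono_poly a * h) m =
    (if \<exists>b\<in>monomials V e. m = a + b then lookup h (THE b. m = a + b) else 0)"
proof (cases "\<exists>b\<in>monomials V e. m = a + b")
  case True
  then obtain b where b: "m = a + b"
    by blast
  have "(THE b'. m = a + b') = b"
    using b by auto
  then show ?thesis
    using True lookup_single_mult[of a 1 h b] by (simp add: mono_poly_def b)
next
  case False
  have "keys h \<subseteq> monomials V e"
    using assms by (auto simp: poly_ring_def homogeneous_of_degree_def monomials_def)
  then have "m \<notin> (+) a ` keys h"
    using False by blast
  then have "m \<notin> keys (mono_poly a * h)"
    using keys_single_mult[of a 1 h] unfolding mono_poly_def by blast
  then show ?thesis
    using False by (simp add: in_keys_iff)
qed


lemma graded_part_mono: "J \<subseteq> J' \<Longrightarrow> graded_part k J \<subseteq> graded_part k J'"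
  by (auto simp: graded_part_def)

lemma graded_part_poly_ring_eqI:
  assumes "p \<in> graded_part k (poly_ring V)" "q \<in> graded_part k (poly_ring V)"
    and "\<And>m. m \<in> monomials V k \<Longrightarrow> lookup p m = lookup q m"
  shows "p = q"
proof (rule poly_mapping_eqI)
  fix m
  have "lookup p m = 0" "lookup q m = 0" if "m \<notin> monomials V k"
    using assms(1,2) that by (auto simp: graded_part_def poly_ring_def homogeneous_of_degree_def
        monomials_def simp flip: not_in_keys_iff_lookup_eq_zero)
  then show "lookup p m = lookup q m"
    using assms(3) by (cases "m \<in> monomials V k") auto
qed

text \<open>
  The transfer principle. Suppose that for one choice of generators of the given degrees all
  monomials of degree \<open>k\<close> lie in the ideal. Then a suitable square matrix of coefficients of
  multiples of the generators is invertible. Its determinant is a polynomial in the coefficients of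
  the generators, not the zero polynomial, so it does not vanish at algebraically independent
  coefficients either.
\<close>

lemma monomials_subset_generic_ideal:
  fixes F :: "'k::field set" and hs :: "(nat, 'k) mpoly list"
  assumes F: "is_subfield F" and V: "finite V" and gen: "generic_generators F V es hs"
    and J: "J \<subseteq> {..<length hs}"
    and h': "\<And>j. j \<in> J \<Longrightarrow> h' j \<in> poly_ring V \<and> homogeneous_of_degree (es ! j) (h' j)"
    and T: "T \<subseteq> poly_ring V" "homogeneous_set T" "\<And>p m. p \<in> T \<Longrightarrow> lookup p m \<in> F"
    and spec: "mono_poly ` monomials V k \<subseteq> ideal_gen V (h' ` J \<union> T)"
  shows "mono_poly ` monomials V k \<subseteq> ideal_gen V ((!) hs ` J \<union> T)"
proof -
  define X where "X = {(j, m). j < length hs \<and> m \<in> monomials V (es ! j)}"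
  define c where "c = (\<lambda>(j, m). lookup (hs ! j) m)"
  define c' where "c' = (\<lambda>(j, m). lookup (h' j) m)"
  let ?M = "monomials V k"
  let ?A = "(!) hs ` J \<union> T" and ?A' = "h' ` J \<union> T"
  have hs: "hs ! j \<in> poly_ring V" "homogeneous_of_degree (es ! j) (hs ! j)" if "j \<in> J" for j
    using gen J that by (auto simp: generic_generators_def)
  have indep: "alg_independent F X c"
    using gen unfolding generic_generators_def X_def c_def by blast
  have A: "?A \<subseteq> poly_ring V" "?A' \<subseteq> poly_ring V" "homogeneous_set ?A'"
    using hs h' T(1,2) unfolding homogeneous_set_def by blast+
  note I = is_ideal_ideal_gen[OF A(1)]
  define Y where "Y = {mono_poly a * h | a h. keys a \<subseteq> V \<and> h \<in> ?A' \<and>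
    homogeneous_of_degree k (mono_poly a * h)}"
  have monoR: "mono_poly ` ?M \<subseteq> graded_part k (poly_ring V :: (nat, 'k) mpoly set)"
    by (auto simp: graded_part_def monomials_def homogeneous_mono_poly intro!: poly_ring_mono_poly)
  have YR: "Y \<subseteq> graded_part k (poly_ring V)"
    unfolding Y_def graded_part_def using A(2) by (auto intro!: poly_ring_mult poly_ring_mono_poly)
  obtain B where B: "B \<subseteq> Y" "mpv.independent B" "Y \<subseteq> mpv.span B"
    by (rule mpv.maximal_independent_subset)
  (* The multiples in B are as many as the monomials of degree k, so their coefficients form a
     square matrix. *)
  have "mono_poly ` ?M \<subseteq> graded_part k (ideal_gen V ?A')"
    using monoR spec by (auto simp: graded_part_def)
  also have "\<dots> \<subseteq> mpv.span Y"
    unfolding Y_def by (rule graded_part_ideal_gen_subset_span[OF A(2,3)])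
  also have "\<dots> \<subseteq> mpv.span B"
    by (rule mpv.span_minimal[OF B(3)]) simp
  finally have mono_span: "mono_poly ` ?M \<subseteq> mpv.span B" .
  have "graded_part k (poly_ring V) \<subseteq> mpv.span (mono_poly ` ?M :: (nat, 'k) mpoly set)"
    using homogeneous_in_span_lead_mons[OF V, of "{}" k "\<lambda>m. 0"] by auto
  then have "B \<subseteq> mpv.span (mono_poly ` ?M)"
    using B(1) YR by blast
  moreover have "finite (mono_poly ` ?M :: (nat, 'k) mpoly set)"
    using finite_monomials[OF V] by simp
  ultimately have B_fin: "finite B" "card B \<le> card (mono_poly ` ?M :: (nat, 'k) mpoly set)"
    using mpv.independent_span_bound[OF _ B(2)] by blast+
  define N where "N = card ?M"
  have "card B \<le> N"
    unfolding N_def using B_fin(2) card_image_le[OF finite_monomials[OF V, of k], of mono_poly]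
    by (rule order_trans)
  moreover have "N \<le> card B"
    unfolding N_def
  proof (rule card_lead_mons_le[OF B_fin(1)])
    fix m assume "m \<in> ?M"
    then show "\<exists>p\<in>mpv.span B. is_lead_mon p m"
      using mono_span by (intro bexI[of _ "mono_poly m"]) (auto simp: lead_mon_mono_poly)
  qed
  ultimately have N: "card B = N"
    by simp
  obtain bM where bM: "bij_betw bM {0..<N} ?M"
    using ex_bij_betw_nat_finite[OF finite_monomials[OF V]] unfolding N_def by blast
  obtain bB where bB: "bij_betw bB {0..<N} B"
    using ex_bij_betw_nat_finite[OF B_fin(1)] unfolding N by blast
  have bMi: "bM i \<in> ?M" if "i < N" for i
    using bij_betwE[OF bM] that by simp
  have bM_surj: "\<exists>i<N. m = bM i" if "m \<in> ?M" for m
    using bij_betw_imp_surj_on[OF bM] that by (metis atLeastLessThan_iff imageE)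
  have bBi: "bB i \<in> B" if "i < N" for i
    using bij_betwE[OF bB] that by simp

  \<comment> \<open>The generic counterpart \<open>u\<close> of a basis vector \<open>v\<close>; one formula \<open>\<phi>\<close> gives the coefficients of both.\<close>
  have "\<exists>u \<phi>. u \<in> graded_part k (ideal_gen V ?A) \<and> (\<forall>m. poly_function F X (\<phi> m) \<and>
      \<phi> m c' = lookup v m \<and> \<phi> m c = lookup u m)" if v: "v \<in> B" for v
  proof -
    obtain a h where ah: "v = mono_poly a * h" "keys a \<subseteq> V" "h \<in> ?A'" "homogeneous_of_degree k v"
      using v B(1) by (auto simp: Y_def)
    have v0: "v \<noteq> 0"
      using v B(2) mpv.dependent_zero by blast
    show ?thesis
    proof (cases "h \<in> T")
      case True
      then obtain e where "homogeneous_of_degree e h"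
        using T(2) by (auto simp: homogeneous_set_def)
      then have vF: "lookup v m \<in> F" for m
        using lookup_single_mult_poly_ring[of h V e a m] True T is_subfield_zero[OF F] ah(1) by auto
      have "v \<in> graded_part k (ideal_gen V ?A)"
        using ah True ideal_gen_superset[of ?A V]
        by (auto simp: graded_part_def intro!: is_ideal_mult[OF I] poly_ring_mono_poly)
      then show ?thesis
        by (intro exI[of _ v] exI[of _ "\<lambda>m _. lookup v m"]) (simp add: poly_function_const F vF)
    next
      case False
      then obtain j where j: "j \<in> J" "h = h' j"
        using ah(3) by blast
      define e where "e = es ! j"
      have h'j: "h' j \<in> poly_ring V" "homogeneous_of_degree e (h' j)"
        and hsj: "hs ! j \<in> poly_ring V" "homogeneous_of_degree e (hs ! j)"
        using h'[OF j(1)] hs[OF j(1)] by (auto simp: e_def)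
      define \<phi> where "\<phi> m x = (if \<exists>b\<in>monomials V e. m = a + b then x (j, THE b. m = a + b) else 0)"
        for m and x :: "nat \<times> mon \<Rightarrow> 'k"
      have "poly_function F X (\<phi> m)" for m
      proof (cases "\<exists>b\<in>monomials V e. m = a + b")
        case True
        then obtain b where b: "b \<in> monomials V e" "m = a + b"
          by blast
        have "(THE b'. m = a + b') = b"
          using b by auto
        then have "\<phi> m = (\<lambda>x. x (j, b))"
          using True by (auto simp: \<phi>_def)
        moreover have "(j, b) \<in> X"
          using b(1) j(1) J by (auto simp: X_def e_def)
        ultimately show ?thesis
          using poly_function_var[OF F] by simp
      next
        case False
        then have "\<phi> m = (\<lambda>x. 0)"
          by (auto simp: \<phi>_def)
        then show ?thesis
          using poly_function_const[OF F is_subfield_zero[OF F]] by simp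
      qed
      moreover have "\<phi> m c' = lookup v m" for m
        unfolding ah(1) j(2) lookup_single_mult_poly_ring[OF h'j] by (simp add: \<phi>_def c'_def)
      moreover have "\<phi> m c = lookup (mono_poly a * hs ! j) m" for m
        unfolding lookup_single_mult_poly_ring[OF hsj] by (simp add: \<phi>_def c_def)
      moreover have "mono_poly a * hs ! j \<in> graded_part k (ideal_gen V ?A)"
      proof -
        obtain m where m: "m \<in> keys v"
          using v0 lead_mon_exists[of v] by (auto simp: is_lead_mon_def)
        have "homogeneous_of_degree (mon_degree a + e) v"
          unfolding ah(1) j(2) by (intro homogeneous_mult h'j homogeneous_mono_poly) simp
        then have "mon_degree a + e = k"
          using m ah(4) by (auto simp: homogeneous_of_degree_def)
        moreover have "homogeneous_of_degree (mon_degree a + e) (mono_poly a * hs ! j)"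
          by (intro homogeneous_mult hsj homogeneous_mono_poly) simp
        moreover have "mono_poly a * hs ! j \<in> ideal_gen V ?A"
          using ah(2) j(1) ideal_gen_superset[of ?A V]
          by (intro is_ideal_mult[OF I] poly_ring_mono_poly) auto
        ultimately show ?thesis
          by (simp add: graded_part_def)
      qed
      ultimately show ?thesis
        by blast
    qed
  qed
  then obtain u \<phi> where u: "\<And>v. v \<in> B \<Longrightarrow> u v \<in> graded_part k (ideal_gen V ?A)"
    and \<phi>: "\<And>v m. v \<in> B \<Longrightarrow> poly_function F X (\<phi> v m)"
    and \<phi>c': "\<And>v m. v \<in> B \<Longrightarrow> \<phi> v m c' = lookup v m"
    and \<phi>c: "\<And>v m. v \<in> B \<Longrightarrow> \<phi> v m c = lookup (u v) m"
    by metis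
  define D where "D x = mat N N (\<lambda>(i, j). \<phi> (bB i) (bM j) x)" for x
  have D: "D x \<in> carrier_mat N N" for x
    by (simp add: D_def)
  have "poly_function F X (\<lambda>x. det (D x))"
    unfolding D_def using \<phi> bBi by (intro poly_function_det[OF F]) auto
  moreover have "det (D c') \<noteq> 0"
  proof -
    have "\<exists>C. mono_poly m = (\<Sum>v\<in>B. scale_poly (C v) v)" if "m \<in> ?M" for m
    proof -
      have "mono_poly m \<in> mpv.span B"
        using that mono_span by blast
      then show ?thesis
        unfolding mpv.span_finite[OF B_fin(1)] by blast
    qed
    then obtain C where C: "\<And>m. m \<in> ?M \<Longrightarrow> mono_poly m = (\<Sum>v\<in>B. scale_poly (C m v) v)"
      by metis
    (* Expanding the monomials in the basis B inverts the matrix at the special point. *)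
    define E where "E = mat N N (\<lambda>(i, l). C (bM i) (bB l))"
    have "E * D c' = 1\<^sub>m N"
    proof (rule eq_matI)
      fix i j assume "i < dim_row (1\<^sub>m N :: 'k mat)" "j < dim_col (1\<^sub>m N :: 'k mat)"
      then have ij: "i < N" "j < N"
        by simp_all
      have "(E * D c') $$ (i, j) = (\<Sum>l\<in>{0..<N}. C (bM i) (bB l) * lookup (bB l) (bM j))"
        using ij bBi by (simp add: E_def D_def scalar_prod_def \<phi>c')
      also have "\<dots> = (\<Sum>v\<in>B. C (bM i) v * lookup v (bM j))"
        by (rule sum.reindex_bij_betw[OF bB])
      also have "\<dots> = lookup (mono_poly (bM i)) (bM j)"
        unfolding C[OF bMi[OF ij(1)]] by (simp add: lookup_sum)
      also have "\<dots> = (if i = j then 1 else 0)"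
        using bM ij by (auto simp: mono_poly_def lookup_single when_def bij_betw_def inj_on_def)
      finally show "(E * D c') $$ (i, j) = 1\<^sub>m N $$ (i, j)"
        using ij by simp
    qed (simp_all add: E_def D_def)
    then have "det E * det (D c') = 1"
      using det_mult[of E N "D c'"] D by (simp add: E_def)
    then show ?thesis
      by auto
  qed
  ultimately have det0: "det (D c) \<noteq> 0"
    by (rule alg_independent_nonzero[OF indep])
  show ?thesis
  proof (rule image_subsetI)
    fix m assume "m \<in> ?M"
    then obtain i where i: "i < N" "m = bM i"
      using bM_surj by blast
    (* Cramer's rule expresses the monomial by the generic counterparts of B. *)
    define p where "p = (\<Sum>l\<in>{0..<N}. scale_poly (adj_mat (D c) $$ (i, l) / det (D c)) (u (bB l)))"
    have uI: "u (bB l) \<in> ideal_gen V ?A" "homogeneous_of_degree k (u (bB l))" if "l \<in> {0..<N}" for l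
      using u bBi that by (auto simp: graded_part_def)
    have pI: "p \<in> graded_part k (ideal_gen V ?A)"
      unfolding p_def using u bBi
      by (intro mpv.subspace_sum mpv.subspace_scale subspace_graded_part[OF I]) auto
    have "mono_poly m = p"
    proof (rule graded_part_poly_ring_eqI)
      show "(mono_poly m :: (nat, 'k) mpoly) \<in> graded_part k (poly_ring V)"
        by (rule subsetD[OF monoR]) (simp add: \<open>m \<in> ?M\<close>)
      show "p \<in> graded_part k (poly_ring V)"
        by (rule subsetD[OF graded_part_mono[OF is_ideal_subset[OF I]] pI])
      fix m' assume "m' \<in> ?M"
      then obtain j where j: "j < N" "m' = bM j"
        using bM_surj by blast
      have Dc: "D c $$ (l, j) = lookup (u (bB l)) m'" if "l < N" for l
        using that j bBi by (simp add: D_def \<phi>c)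
      have "lookup p m' * det (D c) =
          (\<Sum>l\<in>{0..<N}. adj_mat (D c) $$ (i, l) / det (D c) * lookup (u (bB l)) m' * det (D c))"
        by (simp add: p_def lookup_sum sum_distrib_right)
      also have "\<dots> = (\<Sum>l\<in>{0..<N}. adj_mat (D c) $$ (i, l) * D c $$ (l, j))"
      proof (rule sum.cong)
        fix l assume "l \<in> {0..<N}"
        then have "D c $$ (l, j) = lookup (u (bB l)) m'"
          by (simp add: Dc)
        then show "adj_mat (D c) $$ (i, l) / det (D c) * lookup (u (bB l)) m' * det (D c) =
            adj_mat (D c) $$ (i, l) * D c $$ (l, j)"
          using det0 by simp
      qed simp
      also have "\<dots> = (if i = j then det (D c) else 0)"
        by (rule adj_mat_mult_entry[OF D i(1) j(1)])
      also have "\<dots> = lookup (mono_poly m) m' * det (D c)"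
        using bM i j by (auto simp: mono_poly_def lookup_single when_def bij_betw_def inj_on_def)
      finally show "lookup (mono_poly m) m' = lookup p m'"
        using det0 by simp
    qed
    then show "mono_poly m \<in> ideal_gen V ?A"
      using pI by (simp add: graded_part_def)
  qed
qed

section \<open>A complete intersection of Lucas polynomials\<close>

text \<open>
  For \<open>w = 1\<close> and \<open>x\<close> doubled these are the Chebyshev polynomials of the second kind, shifted by one.
\<close>

fun lucas :: "'a::comm_ring_1 \<Rightarrow> 'a \<Rightarrow> nat \<Rightarrow> 'a" where
  "lucas x w 0 = 0"
| "lucas x w (Suc 0) = 1"
| "lucas x w (Suc (Suc k)) = x * lucas x w (Suc k) - w * lucas x w k"

text \<open>
  The difference of the two products is an analogue of a determinant of consecutive terms of the
  recurrence; lowering both indices by one takes out a factor \<open>w\<close>.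
\<close>

lemma lucas_mult_lucas:
  "j \<le> m \<Longrightarrow> lucas x w (Suc m) * lucas x w (Suc j) =
     w ^ j * lucas x w (Suc (m - j)) + lucas x w (Suc (Suc m)) * lucas x w j"
proof (induction j arbitrary: m)
  case (Suc j)
  then obtain l where l: "m = Suc l" "j \<le> l"
    by (cases m) auto
  have "lucas x w (Suc m) * lucas x w (Suc (Suc j)) - lucas x w (Suc (Suc m)) * lucas x w (Suc j) =
      w * (lucas x w (Suc l) * lucas x w (Suc j) - lucas x w (Suc (Suc l)) * lucas x w j)"
    unfolding l(1) lucas.simps(3)[of x w "Suc l"] lucas.simps(3)[of x w j] by (simp add: algebra_simps)
  also have "\<dots> = w ^ Suc j * lucas x w (Suc (m - Suc j))"
    unfolding Suc.IH[OF l(2)] by (simp add: l(1))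
  finally show ?case
    by (simp add: diff_eq_eq)
qed simp

text \<open>
  The Lucas polynomial of the variable \<open>i\<close>, made homogeneous by taking the square of the last
  variable for \<open>w\<close>; the term with index \<open>k + 1\<close> has degree \<open>k\<close>.
\<close>

abbreviation lucas_poly :: "nat \<Rightarrow> nat \<Rightarrow> nat \<Rightarrow> (nat, 'a::comm_ring_1) mpoly" where
  "lucas_poly n i \<equiv> lucas (mono_poly (single i 1)) (mono_poly (single n 2))"

lemma lead_mon_diff:
  assumes p: "is_lead_mon p m" and q: "\<And>m'. m' \<in> keys q \<Longrightarrow> grevlex_less m' m"
  shows "is_lead_mon (p - q) m"
proof -
  have "m \<notin> keys q"
    using q grevlex_irrefl by blast
  then have "m \<in> keys (p - q)"
    using p by (simp add: is_lead_mon_def in_keys_iff lookup_minus)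
  moreover have "m' \<in> keys p \<or> m' \<in> keys q" if "m' \<in> keys (p - q)" for m'
    using that by (auto simp: in_keys_iff lookup_minus)
  ultimately show ?thesis
    using p q by (auto simp: is_lead_mon_def)
qed

lemma homogeneous_diff:
  "homogeneous_of_degree k p \<Longrightarrow> homogeneous_of_degree k q \<Longrightarrow> homogeneous_of_degree k (p - q)"
  by (auto simp: homogeneous_of_degree_def in_keys_iff lookup_minus)

lemma lucas_poly_in_poly_ring: "i \<le> n \<Longrightarrow> lucas_poly n i k \<in> poly_ring {..n}"
  by (induction k rule: induct_nat_012)
    (simp_all add: poly_ring_diff poly_ring_mult poly_ring_mono_poly)

lemma homogeneous_lucas_poly:
  "homogeneous_of_degree k (lucas_poly n i (Suc k) :: (nat, 'a::comm_ring_1) mpoly)"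
proof (induction k rule: induct_nat_012)
  case (ge2 k)
  let ?U = "lucas_poly n i :: nat \<Rightarrow> (nat, 'a) mpoly"
  have "homogeneous_of_degree (1 + Suc k) (mono_poly (single i 1) * ?U (Suc (Suc k)))"
    by (intro homogeneous_mult homogeneous_mono_poly ge2) simp
  moreover have "homogeneous_of_degree (2 + k) (mono_poly (single n 2) * ?U (Suc k))"
    by (intro homogeneous_mult homogeneous_mono_poly ge2) simp
  ultimately show ?case
    unfolding lucas.simps(3)[of _ _ "Suc k"] by (simp add: homogeneous_diff del: lucas.simps)
qed (simp_all add: homogeneous_of_degree_def)

lemma lead_mon_lucas_poly:
  assumes "i < n"
  shows "is_lead_mon (lucas_poly n i (Suc k) :: (nat, 'a::field) mpoly) (single i k)"
proof (induction k rule: induct_nat_012)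
  case (ge2 k)
  let ?U = "lucas_poly n i :: nat \<Rightarrow> (nat, 'a) mpoly"
  have "is_lead_mon (mono_poly (single i 1) * ?U (Suc (Suc k))) (single i 1 + single i (Suc k))"
    by (rule lead_mon_mult[OF lead_mon_mono_poly ge2(2)])
  then have "is_lead_mon (mono_poly (single i 1) * ?U (Suc (Suc k))) (single i (Suc (Suc k)))"
    by (simp flip: single_add)
  moreover have "grevlex_less m (single i (Suc (Suc k)))"
    if m: "m \<in> keys (mono_poly (single n 2) * ?U (Suc k))" for m
  proof (rule grevlex_less_last)
    have "mono_poly (single n 2) * ?U (Suc k) \<in> poly_ring {..n}"
      using assms by (intro poly_ring_mult lucas_poly_in_poly_ring poly_ring_mono_poly) auto
    moreover have "homogeneous_of_degree (2 + k) (mono_poly (single n 2) * ?U (Suc k))"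
      by (intro homogeneous_mult homogeneous_lucas_poly homogeneous_mono_poly) simp
    ultimately show "m \<in> monomials {..n} (2 + k)"
      using m by (auto simp: poly_ring_def homogeneous_of_degree_def monomials_def)
    show "single i (Suc (Suc k)) \<in> monomials {..n} (2 + k)"
      using assms by (simp add: monomials_def)
    show "lookup (single i (Suc (Suc k))) n < lookup m n"
      using keys_mult[of "mono_poly (single n 2)" "?U (Suc k)"] m assms
      by (auto simp: lookup_add lookup_single when_def)
  qed
  ultimately show ?case
    unfolding lucas.simps(3)[of _ _ "Suc k"] by (rule lead_mon_diff)
qed (use lead_mon_mono_poly[of 0] lead_mon_mono_poly[of "single i 1"] in simp_all)

lemma lead_mon_prod:
  fixes f :: "'i \<Rightarrow> (nat, 'a::field) mpoly"
  assumes "\<And>i. i \<in> A \<Longrightarrow> is_lead_mon (f i) (m i)"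
  shows "is_lead_mon (prod f A) (sum m A)"
  using assms
proof (induction A rule: infinite_finite_induct)
  case (insert i A)
  then show ?case
    by (simp add: lead_mon_mult)
qed (use lead_mon_mono_poly[of 0] in simp_all)

lemma homogeneous_prod:
  assumes "\<And>i. i \<in> A \<Longrightarrow> homogeneous_of_degree (d i) (f i)"
  shows "homogeneous_of_degree (sum d A) (prod f A)"
  using assms
proof (induction A rule: infinite_finite_induct)
  case (insert i A)
  then show ?case
    by (simp add: homogeneous_mult)
qed (use homogeneous_mono_poly[of 0] in simp_all)

lemma prod_diff_in_ideal:
  assumes I: "is_ideal V I" and "\<And>i. i \<in> A \<Longrightarrow> a i \<in> poly_ring V" "\<And>i. i \<in> A \<Longrightarrow> b i \<in> poly_ring V"
    and "\<And>i. i \<in> A \<Longrightarrow> a i - b i \<in> I"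
  shows "prod a A - prod b A \<in> I"
  using assms(2-)
proof (induction A rule: infinite_finite_induct)
  case (insert i A)
  have "prod a (insert i A) - prod b (insert i A) =
      a i * (prod a A - prod b A) + prod b A * (a i - b i)"
    using insert.hyps by (simp add: algebra_simps)
  also have "\<dots> \<in> I"
    using insert by (intro is_ideal_add[OF I] is_ideal_mult[OF I] poly_ring_prod) auto
  finally show ?case .
qed (simp_all add: is_ideal_zero[OF I])

lemma mon_decompose:
  fixes m :: mon
  assumes "keys m \<subseteq> {..n}"
  shows "m = single n (lookup m n) + (\<Sum>i<n. single i (lookup m i))"
proof (rule poly_mapping_eqI)
  fix j
  have "lookup (\<Sum>i<n. single i (lookup m i)) j = (\<Sum>i<n. if i = j then lookup m j else 0)"
    unfolding lookup_sum by (intro sum.cong) (auto simp: lookup_single when_def)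
  moreover have "lookup m j = 0" if "j > n"
  proof -
    have "j \<notin> keys m"
      using subsetD[OF assms, of j] that by auto
    then show ?thesis
      by (simp add: in_keys_iff)
  qed
  ultimately show "lookup m j = lookup (single n (lookup m n) + (\<Sum>i<n. single i (lookup m i))) j"
    by (cases j n rule: linorder_cases) (auto simp: lookup_add lookup_single when_def)
qed

lemma mon_degree_last:
  fixes m :: mon
  assumes "keys m \<subseteq> {..n}"
  shows "mon_degree m = lookup m n + (\<Sum>i<n. lookup m i)"
  using mon_degree_eq_sum[OF _ assms] by (simp flip: lessThan_Suc_atMost)

lemma mono_poly_in_idealI:
  assumes I: "is_ideal V I" and a: "mono_poly a \<in> I" and m: "keys m \<subseteq> V" "\<And>i. lookup a i \<le> lookup m i"
  shows "mono_poly m \<in> I"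
proof -
  obtain b where b: "m = a + b" "keys b \<subseteq> keys m"
    using mon_eq_add_of_le[OF m(2)] by blast
  have "mono_poly b * mono_poly a \<in> I"
    using m(1) b(2) by (intro is_ideal_mult[OF I _ a] poly_ring_mono_poly) blast
  then show ?thesis
    by (simp add: b(1) add.commute flip: mono_poly_add)
qed

text \<open>
  An ideal without standard monomials in degree \<open>k\<close> has codimension zero there.
\<close>

lemma monomials_subset_of_lead_mons:
  fixes A :: "(nat, 'a::field) mpoly set"
  assumes V: "finite V" and A: "A \<subseteq> poly_ring V" "homogeneous_set A"
    and lead: "monomials V k \<subseteq> lead_mons k (ideal_gen V A)"
  shows "mono_poly ` monomials V k \<subseteq> ideal_gen V A"
proof -
  let ?I = "ideal_gen V A"
  note I = is_ideal_ideal_gen[OF A(1)]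
  have "monomials V k - lead_mons k ?I = {}"
    using lead by blast
  moreover from graded_part_basis[OF V A, of k] obtain w where w: "w ` lead_mons k ?I \<subseteq> graded_part k ?I"
    and "graded_part k (poly_ring V) \<subseteq>
      mpv.span (w ` lead_mons k ?I \<union> mono_poly ` (monomials V k - lead_mons k ?I))"
    by (elim exE conjE) (rule that)
  ultimately have R: "graded_part k (poly_ring V) \<subseteq> mpv.span (w ` lead_mons k ?I)"
    by (simp only: image_empty Un_empty_right)
  have "mono_poly ` monomials V k \<subseteq> graded_part k (poly_ring V :: (nat, 'a) mpoly set)"
    by (auto simp: graded_part_def monomials_def homogeneous_mono_poly intro!: poly_ring_mono_poly)
  also have "\<dots> \<subseteq> mpv.span (w ` lead_mons k ?I)"
    by (rule R)
  also have "\<dots> \<subseteq> graded_part k ?I"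
    using w subspace_graded_part[OF I] by (rule mpv.span_minimal)
  finally show ?thesis
    by (auto simp: graded_part_def)
qed

text \<open>
  It suffices to see every monomial as a leading monomial. Only box monomials with a small exponent
  of \<open>z\<close> are not obvious. For those, with exponents \<open>\<alpha>\<^sub>i\<close>, multiply \<open>g\<close> by the product of the Lucas
  polynomials of degrees \<open>\<beta>\<^sub>i = e\<^sub>i - 1 - \<alpha>\<^sub>i\<close>: modulo the other generators the result is the product of
  those of degrees \<open>\<alpha>\<^sub>i\<close> times \<open>z\<close> to the power \<open>d - \<delta> + 2 \<Sum>\<beta>\<^sub>i\<close>. The degree \<open>d + s\<close> leaves room for
  this exactly if \<open>\<Sum>\<beta>\<^sub>i \<le> s\<close>, which is the bound on the exponent of \<open>z\<close>.
\<close>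

lemma lucas_ideal_contains_monomials:
  fixes e :: "nat \<Rightarrow> nat" and n d s :: nat
  defines "\<delta> \<equiv> \<Sum>i<n. e i - 1"
  defines "g \<equiv> mono_poly (single n (d - \<delta>)) * (\<Prod>i<n. lucas_poly n i (e i))"
  defines "A \<equiv> insert (mono_poly (single n (d + 2 * s - \<delta> + 1)))
    (insert g ((\<lambda>i. lucas_poly n i (Suc (e i))) ` {..<n})) :: (nat, 'a::field) mpoly set"
  assumes e: "\<And>i. i < n \<Longrightarrow> e i \<ge> 1" and d: "\<delta> \<le> d" and s: "s \<le> \<delta>"
  shows "A \<subseteq> poly_ring {..n}" "homogeneous_of_degree d g"
    and "mono_poly ` monomials {..n} (d + s) \<subseteq> ideal_gen {..n} A"
proof -
  let ?U = "lucas_poly n :: nat \<Rightarrow> nat \<Rightarrow> (nat, 'a) mpoly"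
  let ?V = "{..n}" and ?k = "d + s"
  let ?z = "\<lambda>j. mono_poly (single n j) :: (nat, 'a) mpoly"
  have z: "?z j \<in> poly_ring ?V" "homogeneous_of_degree j (?z j)" for j
    by (auto intro!: poly_ring_mono_poly homogeneous_mono_poly split: if_splits)
  have U: "?U i j \<in> poly_ring ?V" if "i < n" for i j
    using that by (intro lucas_poly_in_poly_ring) simp
  have Upre: "homogeneous_of_degree (e i - 1) (?U i (e i))" if "i < n" for i
    using homogeneous_lucas_poly[of "e i - 1" i n] e[OF that] by simp
  have g: "g \<in> poly_ring ?V"
    unfolding g_def using z U by (intro poly_ring_mult poly_ring_prod) auto
  show A: "A \<subseteq> poly_ring ?V"
    unfolding A_def using z g U by auto
  have "homogeneous_of_degree (d - \<delta> + \<delta>) g"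
    unfolding g_def \<delta>_def using Upre by (intro homogeneous_mult z homogeneous_prod) auto
  then show hg: "homogeneous_of_degree d g"
    using d by simp
  have Ahom: "homogeneous_set A"
    unfolding A_def homogeneous_set_def using hg z(2) homogeneous_lucas_poly by blast
  let ?L = "ideal_gen ?V A"
  note L = is_ideal_ideal_gen[OF A]
  have AL: "p \<in> ?L" if "p \<in> A" for p
    using ideal_gen_superset that by blast
  show "mono_poly ` monomials ?V ?k \<subseteq> ?L"
  proof (rule monomials_subset_of_lead_mons[OF finite_atMost A Ahom], rule subsetI)
    fix m assume "m \<in> monomials ?V ?k"
    then have m: "keys m \<subseteq> ?V" "mon_degree m = ?k"
      by (auto simp: monomials_def)
    have "\<exists>p\<in>?L. is_lead_mon p m"
    proof -
      consider (x) i where "i < n" "e i \<le> lookup m i" | (z) "d + 2 * s - \<delta> + 1 \<le> lookup m n"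
        | (box) "\<And>i. i < n \<Longrightarrow> lookup m i < e i" "lookup m n \<le> d + 2 * s - \<delta>"
        by fastforce
      then show ?thesis
      proof cases
        case x
        have "lookup (single i (e i)) j \<le> lookup m j" for j
          using x(2) by (cases "i = j") (simp_all add: lookup_single)
        then obtain b where b: "m = single i (e i) + b" "keys b \<subseteq> keys m"
          using mon_eq_add_of_le by blast
        have "is_lead_mon (mono_poly b * ?U i (Suc (e i))) (b + single i (e i))"
          by (rule lead_mon_mult[OF lead_mon_mono_poly lead_mon_lucas_poly[OF x(1)]])
        moreover have "mono_poly b * ?U i (Suc (e i)) \<in> ?L"
          using b(2) m(1) x(1) by (intro is_ideal_mult[OF L] poly_ring_mono_poly AL) (auto simp: A_def)
        ultimately show ?thesis
          by (auto simp: b(1) add.commute)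
      next
        case z
        have "mono_poly m \<in> ?L"
          using z m(1) by (intro mono_poly_in_idealI[OF L AL, of "single n (d + 2 * s - \<delta> + 1)"])
            (auto simp: A_def lookup_single when_def)
        then show ?thesis
          using lead_mon_mono_poly by blast
      next
        case box
        define \<alpha> where "\<alpha> i = lookup m i" for i
        define \<beta> where "\<beta> i = e i - 1 - \<alpha> i" for i
        define a where "a = lookup m n"
        have \<alpha>: "\<alpha> i < e i" if "i < n" for i
          using box(1) that by (simp add: \<alpha>_def)
        have "sum \<alpha> {..<n} + sum \<beta> {..<n} = (\<Sum>i<n. e i - 1)"
          unfolding sum.distrib[symmetric]
        proof (rule sum.cong)
          fix i assume "i \<in> {..<n}"
          then show "\<alpha> i + \<beta> i = e i - 1"
            using \<alpha>[of i] by (simp add: \<beta>_def)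
        qed simp
        then have \<alpha>\<beta>: "sum \<alpha> {..<n} + sum \<beta> {..<n} = \<delta>"
          by (simp add: \<delta>_def)
        have a: "a + sum \<alpha> {..<n} = d + s"
          using mon_degree_last[OF m(1)] m(2) by (simp add: a_def \<alpha>_def)
        have \<beta>s: "sum \<beta> {..<n} \<le> s"
          using box(2) a \<alpha>\<beta> d by (simp add: a_def)
        let ?P = "\<Prod>i<n. ?U i (e i) * ?U i (Suc (\<beta> i))"
        let ?Q = "\<Prod>i<n. ?z 2 ^ \<beta> i * ?U i (Suc (\<alpha> i))"
        have "?U i (e i) * ?U i (Suc (\<beta> i)) - ?z 2 ^ \<beta> i * ?U i (Suc (\<alpha> i)) \<in> ?L"
          if i: "i \<in> {..<n}" for i
        proof -
          have "Suc (e i - 1) = e i" "e i - 1 - \<beta> i = \<alpha> i"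
            using \<alpha>[of i] i by (auto simp: \<beta>_def)
          then have "?U i (e i) * ?U i (Suc (\<beta> i)) - ?z 2 ^ \<beta> i * ?U i (Suc (\<alpha> i)) =
              ?U i (\<beta> i) * ?U i (Suc (e i))"
            using lucas_mult_lucas[of "\<beta> i" "e i - 1" "mono_poly (single i 1)" "?z 2"]
            by (simp add: \<beta>_def mult.commute)
          also have "\<dots> \<in> ?L"
            using i U by (intro is_ideal_mult[OF L] AL) (auto simp: A_def)
          finally show ?thesis .
        qed
        moreover have "?z 2 ^ j \<in> poly_ring ?V" for j
          by (induction j) (auto intro: poly_ring_mult z)
        ultimately have "?P - ?Q \<in> ?L"
          using U by (intro prod_diff_in_ideal[OF L] poly_ring_mult) auto
        then have 1: "?z (s - sum \<beta> {..<n} + (d - \<delta>)) * (?P - ?Q) \<in> ?L"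
          by (intro is_ideal_mult[OF L] z)
        have "?z (s - sum \<beta> {..<n}) * (\<Prod>i<n. ?U i (Suc (\<beta> i))) * g \<in> ?L"
          using U z by (intro is_ideal_mult[OF L] AL poly_ring_mult poly_ring_prod) (auto simp: A_def)
        also have "?z (s - sum \<beta> {..<n}) * (\<Prod>i<n. ?U i (Suc (\<beta> i))) * g =
            ?z (s - sum \<beta> {..<n} + (d - \<delta>)) * ?P"
          by (simp add: g_def prod.distrib mono_poly_add single_add mult_ac)
        finally have 2: "?z (s - sum \<beta> {..<n} + (d - \<delta>)) * ?P \<in> ?L" .
        have z_pow: "?z 2 ^ j = ?z (2 * j)" for j
          by (induction j) (simp_all flip: mono_poly_add single_add)
        have "?z (s - sum \<beta> {..<n} + (d - \<delta>)) * ?Q \<in> ?L"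
          using is_ideal_diff[OF L 2 1] by (simp add: right_diff_distrib)
        also have "?Q = ?z (2 * sum \<beta> {..<n}) * (\<Prod>i<n. ?U i (Suc (\<alpha> i)))"
          by (simp only: prod.distrib power_sum[symmetric]) (simp only: z_pow)
        also have "?z (s - sum \<beta> {..<n} + (d - \<delta>)) * \<dots> =
            ?z (s - sum \<beta> {..<n} + (d - \<delta>) + 2 * sum \<beta> {..<n}) * (\<Prod>i<n. ?U i (Suc (\<alpha> i)))"
          by (simp add: single_add mono_poly_add mult.assoc)
        also have "s - sum \<beta> {..<n} + (d - \<delta>) + 2 * sum \<beta> {..<n} = a"
          using a \<alpha>\<beta> \<beta>s d by linarith
        finally have "?z a * (\<Prod>i<n. ?U i (Suc (\<alpha> i))) \<in> ?L" .
        moreover have "is_lead_mon (?z a * (\<Prod>i<n. ?U i (Suc (\<alpha> i)))) (single n a + (\<Sum>i<n. single i (\<alpha> i)))"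
          by (intro lead_mon_mult lead_mon_prod lead_mon_mono_poly lead_mon_lucas_poly) simp
        moreover have "single n a + (\<Sum>i<n. single i (\<alpha> i)) = m"
          using mon_decompose[OF m(1)] by (simp add: a_def \<alpha>_def)
        ultimately show ?thesis
          by auto
      qed
    qed
    then show "m \<in> lead_mons ?k ?L"
      using m(2) by (simp add: lead_mons_def)
  qed
qed

section \<open>Leading monomials of generic ideals\<close>

text \<open>
  All ideals generated by an initial segment of the generic generators occur, since dimensions are
  computed by induction on the number of generators; the full ideal is the one with index \<open>n + 1\<close>.
\<close>

locale generic_ideal =
  fixes F :: "'k::field set" and n :: nat and e :: "nat \<Rightarrow> nat" and es :: "nat list"
    and hs :: "(nat, 'k) mpoly list"
  assumes subfield: "is_subfield F"
    and generic: "generic_generators F {..n} es hs"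
    and length_es: "length es = Suc n"
  defines "e \<equiv> (!) es"
begin

definition partial_ideal :: "nat \<Rightarrow> (nat, 'k) mpoly set" where
  "partial_ideal j = ideal_gen {..n} ((!) hs ` {..<j})"

definition box :: "nat \<Rightarrow> nat \<Rightarrow> mon set" where
  "box j k = {m \<in> monomials {..n} k. \<forall>i<j. lookup m i < e i}"

definition box_without_last :: "nat \<Rightarrow> mon set" where
  "box_without_last k = {m \<in> monomials {..<n} k. \<forall>i<n. lookup m i < e i}"

definition socle_degree :: nat where
  "socle_degree = (\<Sum>i<n. e i - 1)"

lemma length_hs: "length hs = Suc n"
  using generic length_es by (simp add: generic_generators_def)

lemma e_pos: "i \<le> n \<Longrightarrow> 1 \<le> e i"
  using generic length_es by (auto simp: generic_generators_def e_def)

lemma hs_in_poly_ring: "i \<le> n \<Longrightarrow> hs ! i \<in> poly_ring {..n}"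
  and homogeneous_hs: "i \<le> n \<Longrightarrow> homogeneous_of_degree (e i) (hs ! i)"
  using generic length_hs by (auto simp: generic_generators_def e_def)

lemma generators:
  assumes "j \<le> Suc n"
  shows "(!) hs ` {..<j} \<subseteq> poly_ring {..n}" "homogeneous_set ((!) hs ` {..<j})"
proof -
  have "hs ! i \<in> poly_ring {..n}" "homogeneous_of_degree (e i) (hs ! i)" if "i < j" for i
    using hs_in_poly_ring homogeneous_hs assms that by auto
  then show "(!) hs ` {..<j} \<subseteq> poly_ring {..n}" "homogeneous_set ((!) hs ` {..<j})"
    unfolding homogeneous_set_def by blast+
qed

lemma is_ideal_partial_ideal: "j \<le> Suc n \<Longrightarrow> is_ideal {..n} (partial_ideal j)"
  unfolding partial_ideal_def by (intro is_ideal_ideal_gen generators)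

lemma partial_ideal_Suc: "partial_ideal (Suc j) = ideal_gen {..n} (insert (hs ! j) ((!) hs ` {..<j}))"
  by (simp add: partial_ideal_def lessThan_Suc)

lemma partial_ideal_mono: "j \<le> j' \<Longrightarrow> partial_ideal j \<subseteq> partial_ideal j'"
  unfolding partial_ideal_def by (intro ideal_gen_mono) auto

lemma lead_mons_partial_ideal_subset: "j \<le> Suc n \<Longrightarrow> lead_mons k (partial_ideal j) \<subseteq> monomials {..n} k"
  by (intro lead_mons_subset_monomials is_ideal_subset is_ideal_partial_ideal)

lemma box_subset: "box j k \<subseteq> monomials {..n} k"
  by (auto simp: box_def)

lemma finite_box: "finite (box j k)"
  by (rule finite_subset[OF box_subset finite_monomials[OF finite_atMost]])

text \<open>
  The form of the transfer principle in which only monomials are adjoined to the generators.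
\<close>

lemma generic_spanning:
  fixes h :: "nat \<Rightarrow> (nat, 'k) mpoly"
  assumes "j \<le> Suc n"
    and "\<And>i. i < j \<Longrightarrow> h i \<in> poly_ring {..n}" "\<And>i. i < j \<Longrightarrow> homogeneous_of_degree (e i) (h i)"
    and T: "\<And>m. m \<in> T \<Longrightarrow> keys m \<subseteq> {..n}"
    and spec: "mono_poly ` monomials {..n} k \<subseteq> ideal_gen {..n} (h ` {..<j} \<union> mono_poly ` T)"
  shows "mono_poly ` monomials {..n} k \<subseteq> ideal_gen {..n} ((!) hs ` {..<j} \<union> mono_poly ` T)"
proof (rule monomials_subset_generic_ideal[OF subfield _ generic, where h' = h])
  show "homogeneous_set (mono_poly ` T :: (nat, 'k) mpoly set)"
    using homogeneous_mono_poly unfolding homogeneous_set_def by blast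
  show "mono_poly ` T \<subseteq> (poly_ring {..n} :: (nat, 'k) mpoly set)"
    using T by (auto intro!: poly_ring_mono_poly)
  show "lookup p m \<in> F" if "p \<in> mono_poly ` T" for p m
    using that is_subfield_zero[OF subfield] is_subfield_one[OF subfield]
    by (auto simp: mono_poly_def lookup_single when_def)
  show "{..<j} \<subseteq> {..<length hs}"
    using assms(1) by (simp add: length_hs)
  show "h i \<in> poly_ring {..n} \<and> homogeneous_of_degree (es ! i) (h i)" if "i \<in> {..<j}" for i
    using assms(2,3)[of i] that by (simp add: e_def)
qed (use spec in simp_all)

lemma monomials_subset_power_ideal:
  assumes "j \<le> Suc n" "\<And>m. m \<in> T \<Longrightarrow> keys m \<subseteq> {..n}"
    and "\<And>m. m \<in> monomials {..n} k \<Longrightarrow> (\<And>i. i < j \<Longrightarrow> lookup m i < e i) \<Longrightarrow>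
      \<exists>t\<in>T. \<forall>i. lookup t i \<le> lookup m i"
  shows "mono_poly ` monomials {..n} k \<subseteq>
    ideal_gen {..n} ((\<lambda>i. mono_poly (single i (e i))) ` {..<j} \<union> mono_poly ` T :: (nat, 'k) mpoly set)"
    (is "_ \<subseteq> ideal_gen _ ?A")
proof (rule image_subsetI)
  have "?A \<subseteq> poly_ring {..n}"
    using assms(1,2) by (auto intro!: poly_ring_mono_poly split: if_splits)
  then have L: "is_ideal {..n} (ideal_gen {..n} ?A)"
    by (rule is_ideal_ideal_gen)
  fix m assume m: "m \<in> monomials {..n} k"
  have "\<exists>a. mono_poly a \<in> ?A \<and> (\<forall>i. lookup a i \<le> lookup m i)"
  proof (cases "\<forall>i<j. lookup m i < e i")
    case True
    then obtain t where "t \<in> T" "\<forall>i. lookup t i \<le> lookup m i"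
      using assms(3)[OF m] by blast
    then show ?thesis
      by (intro exI[of _ t]) simp
  next
    case False
    then obtain i where i: "i < j" "e i \<le> lookup m i"
      by (auto simp: not_less)
    then have "lookup (single i (e i)) l \<le> lookup m l" for l
      by (cases "i = l") (simp_all add: lookup_single)
    with i(1) show ?thesis
      by (intro exI[of _ "single i (e i)"]) simp
  qed
  then obtain a where a: "mono_poly a \<in> ideal_gen {..n} ?A" "\<And>i. lookup a i \<le> lookup m i"
    using ideal_gen_superset[of ?A "{..n}"] by blast
  show "mono_poly m \<in> ideal_gen {..n} ?A"
    using m by (intro mono_poly_in_idealI[OF L a(1) _ a(2)]) (simp add: monomials_def)
qed

lemma single_e_in_poly_ring: "i \<le> n \<Longrightarrow> (mono_poly (single i (e i)) :: (nat, 'k) mpoly) \<in> poly_ring {..n}"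
  by (intro poly_ring_mono_poly) auto

text \<open>
  The monomials that leave the box when the exponent of the variable \<open>j\<close> becomes bounded are the
  multiples of its power by \<open>e j\<close>. This is the recursion for the Hilbert function of a regular sequence.
\<close>

lemma card_box_Suc:
  assumes "j \<le> n"
  shows "card (box j k) = card (box (Suc j) k) + (if e j \<le> k then card (box j (k - e j)) else 0)"
proof -
  let ?s = "single j (e j)"
  define C where "C = (if e j \<le> k then (+) ?s ` box j (k - e j) else {})"
  have "box j k - box (Suc j) k \<subseteq> C"
  proof
    fix m assume m: "m \<in> box j k - box (Suc j) k"
    then have ge: "e j \<le> lookup m j"
      by (auto simp: box_def less_Suc_eq)
    then have "lookup ?s i \<le> lookup m i" for i
      by (cases "j = i") (simp_all add: lookup_single)
    then obtain b where b: "m = ?s + b" "keys b \<subseteq> keys m"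
      using mon_eq_add_of_le by blast
    have k: "mon_degree m = k" "keys m \<subseteq> {..n}"
      using m by (auto simp: box_def monomials_def)
    then have deg: "e j + mon_degree b = k"
      by (simp add: b(1) mon_degree_add)
    moreover have "lookup b i < e i" if "i < j" for i
    proof -
      have "lookup m i < e i"
        using m that by (simp add: box_def)
      then show ?thesis
        using that by (simp add: b(1) lookup_add)
    qed
    ultimately have "b \<in> box j (k - e j)"
      using b(2) k by (auto simp: box_def monomials_def)
    then show "m \<in> C"
      using deg by (auto simp: C_def b(1))
  qed
  moreover have "C \<subseteq> box j k - box (Suc j) k"
  proof
    fix m assume "m \<in> C"
    then obtain b where b: "e j \<le> k" "b \<in> box j (k - e j)" "m = ?s + b"
      by (auto simp: C_def split: if_splits)
    then have "m \<in> box j k"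
      using assms by (auto simp: box_def monomials_def mon_degree_add keys_add_mon lookup_add
          lookup_single when_def)
    moreover have "e j \<le> lookup m j"
      by (simp add: b(3) lookup_add)
    then have "m \<notin> box (Suc j) k"
      by (auto simp: box_def not_less)
    ultimately show "m \<in> box j k - box (Suc j) k"
      by blast
  qed
  ultimately have C: "box j k - box (Suc j) k = C"
    by blast
  have "box (Suc j) k \<subseteq> box j k"
    by (auto simp: box_def)
  then have "card (box j k) = card (box (Suc j) k) + card (box j k - box (Suc j) k)"
    using finite_box by (metis card_Diff_subset card_mono le_add_diff_inverse)
  moreover have "card C = (if e j \<le> k then card (box j (k - e j)) else 0)"
    by (simp add: C_def card_image)
  ultimately show ?thesis
    by (simp add: C)
qed

text \<open>
  The generators form a regular sequence, seen through dimensions: each ideal in the chain has as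
  many leading monomials in every degree as the ideal of pure powers of the first variables. Transfer
  from the pure powers gives one inequality; the other one is the bound on what a new generator adds.
\<close>

lemma card_lead_mons_partial_ideal:
  assumes "j \<le> n"
  shows "card (lead_mons k (partial_ideal j)) + card (box j k) = card (monomials {..n} k)"
  using assms
proof (induction j arbitrary: k)
  case 0
  have "is_ideal {..n} {0 :: (nat, 'k) mpoly}"
    by (rule is_idealI) auto
  then have "partial_ideal 0 \<subseteq> {0}"
    unfolding partial_ideal_def by (intro ideal_gen_minimal) auto
  then have "lead_mons k (partial_ideal 0) = {}"
    by (auto simp: lead_mons_def is_lead_mon_def)
  moreover have "box 0 k = monomials {..n} k"
    by (simp add: box_def)
  ultimately show ?case
    by simp
next
  case (Suc j)
  let ?M = "\<lambda>k. monomials {..n} k" and ?L = "\<lambda>k. lead_mons k (partial_ideal j)"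
  have gens: "(!) hs ` {..<j} \<subseteq> poly_ring {..n}" "homogeneous_set ((!) hs ` {..<j})"
    using generators[of j] Suc.prems by auto
  have "card (lead_mons k (partial_ideal (Suc j))) \<le> card (?L k) +
      (if e j \<le> k then card (?M (k - e j) - ?L (k - e j)) else 0)"
    unfolding partial_ideal_Suc unfolding partial_ideal_def using Suc.prems
    by (intro card_lead_mons_insert_le gens hs_in_poly_ring homogeneous_hs) auto
  moreover have "card (?M l - ?L l) = card (box j l)" for l
  proof -
    have "card (?M l - ?L l) = card (?M l) - card (?L l)"
      using lead_mons_partial_ideal_subset[of j l] Suc.prems finite_subset[OF _ finite_monomials]
      by (intro card_Diff_subset) auto
    then show ?thesis
      using Suc.IH[of l] Suc.prems by simp
  qed
  moreover have "card (box j k) = card (box (Suc j) k) + (if e j \<le> k then card (box j (k - e j)) else 0)"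
    using Suc.prems by (intro card_box_Suc) simp
  ultimately have "card (lead_mons k (partial_ideal (Suc j))) + card (box (Suc j) k) \<le> card (?M k)"
    using Suc.IH[of k] Suc.prems by (simp split: if_splits)
  moreover have "card (?M k) \<le> card (lead_mons k (partial_ideal (Suc j))) + card (box (Suc j) k)"
    unfolding partial_ideal_def
  proof (rule card_monomials_le)
    show "mono_poly ` ?M k \<subseteq> ideal_gen {..n} ((!) hs ` {..<Suc j} \<union> mono_poly ` box (Suc j) k)"
    proof (rule generic_spanning)
      show "mono_poly ` ?M k \<subseteq> ideal_gen {..n}
          ((\<lambda>i. mono_poly (single i (e i))) ` {..<Suc j} \<union> mono_poly ` box (Suc j) k :: (nat, 'k) mpoly set)"
        using Suc.prems by (intro monomials_subset_power_ideal) (auto simp: box_def monomials_def)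
    qed (use Suc.prems single_e_in_poly_ring in
        \<open>auto simp: box_def monomials_def intro!: homogeneous_mono_poly\<close>)
  qed (use generators[of "Suc j"] Suc.prems in \<open>auto simp: box_def\<close>)
  ultimately show ?case
    by (rule antisym)
qed

lemma finite_box_without_last: "finite (box_without_last k)"
  unfolding box_without_last_def using finite_monomials[of "{..<n}" k] by simp

lemma standard_monomials_subset: "standard_monomials n (partial_ideal n) k \<subseteq> monomials {..<n} k"
  by (auto simp: standard_monomials_def)

lemma mono_poly_in_initial_ideal_partial_iff:
  "j \<le> Suc n \<Longrightarrow> mono_poly m \<in> initial_ideal {..n} (partial_ideal j) \<longleftrightarrow> m \<in> lead_mons (mon_degree m) (partial_ideal j)"
  using mono_poly_in_initial_ideal_iff[OF is_ideal_partial_ideal, of j m] by (simp add: lead_mons_def)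

text \<open>
  Modulo \<open>z\<close> the pure powers again leave the box monomials, so by transfer the box monomials span
  the residue ring of the generic ideal modulo \<open>z\<close>.
\<close>

lemma card_standard_monomials_le:
  "card (standard_monomials n (partial_ideal n) k) \<le> card (box_without_last k)"
proof -
  let ?B = "standard_monomials n (partial_ideal n) k" and ?M = "monomials {..n} k"
  let ?A = "insert (mono_poly (single n 1)) ((!) hs ` {..<n})"
  let ?T = "insert (single n 1) (box_without_last k)"
  have z: "mono_poly (single n 1) \<in> (poly_ring {..n} :: (nat, 'k) mpoly set)"
    "homogeneous_of_degree 1 (mono_poly (single n 1) :: (nat, 'k) mpoly)"
    by (auto intro!: poly_ring_mono_poly homogeneous_mono_poly)
  have A: "?A \<subseteq> poly_ring {..n}" "homogeneous_set ?A"
    using generators[of n] z by (auto simp: homogeneous_set_def)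
  have BM: "?B \<subseteq> ?M" "box_without_last k \<subseteq> ?M"
    by (auto simp: standard_monomials_def box_without_last_def monomials_def)
  have "mono_poly ` ?M \<subseteq> ideal_gen {..n} ((!) hs ` {..<n} \<union> mono_poly ` ?T)"
  proof (rule generic_spanning)
    show "mono_poly ` ?M \<subseteq>
        ideal_gen {..n} ((\<lambda>i. mono_poly (single i (e i))) ` {..<n} \<union> mono_poly ` ?T :: (nat, 'k) mpoly set)"
    proof (rule monomials_subset_power_ideal)
      fix m assume m: "m \<in> ?M" "\<And>i. i < n \<Longrightarrow> lookup m i < e i"
      show "\<exists>t\<in>?T. \<forall>i. lookup t i \<le> lookup m i"
      proof (cases "lookup m n = 0")
        case True
        then have "n \<notin> keys m"
          by (simp add: in_keys_iff)
        moreover have "keys m \<subseteq> {..n}"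
          using m(1) by (simp add: monomials_def)
        ultimately have "keys m \<subseteq> {..<n}"
          by (force simp: nat_less_le)
        then have "m \<in> ?T"
          using m by (auto simp: box_without_last_def monomials_def)
        then show ?thesis
          by blast
      next
        case False
        then show ?thesis
          by (intro bexI[of _ "single n 1"]) (auto simp: lookup_single when_def)
      qed
    qed (auto simp: box_without_last_def monomials_def split: if_splits)
  qed (use single_e_in_poly_ring in \<open>auto simp: box_without_last_def monomials_def
      split: if_splits intro!: homogeneous_mono_poly\<close>)
  then have "mono_poly ` ?M \<subseteq> ideal_gen {..n} (?A \<union> mono_poly ` box_without_last k)"
    by simp
  then have "card ?M \<le> card (lead_mons k (ideal_gen {..n} ?A)) + card (box_without_last k)"
    using BM(2) by (intro card_monomials_le A) auto
  moreover have "lead_mons k (ideal_gen {..n} ?A) \<subseteq> ?M - ?B"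
  proof
    fix m assume m: "m \<in> lead_mons k (ideal_gen {..n} ?A)"
    have "m \<in> ?M"
      using m lead_mons_subset_monomials[OF is_ideal_subset[OF is_ideal_ideal_gen[OF A(1)]]] by blast
    moreover have False if mB: "m \<in> ?B"
    proof -
      have "n \<notin> keys m"
        using mB by (auto simp: standard_monomials_def monomials_def)
      then have "lookup m n < 1"
        by (simp add: in_keys_iff)
      moreover obtain p where "p \<in> graded_part k (ideal_gen {..n} ?A)" "is_lead_mon p m"
        using lead_mons_homogeneousE[OF A m] by blast
      ultimately have "m \<in> lead_mons k (partial_ideal n)"
        unfolding partial_ideal_def using generators[of n] by (intro lead_mon_without_last_power) auto
      then show False
        using mB mono_poly_in_initial_ideal_partial_iff[of n m]
        by (auto simp: standard_monomials_def lead_mons_def)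
    qed
    ultimately show "m \<in> ?M - ?B"
      by blast
  qed
  then have "card (lead_mons k (ideal_gen {..n} ?A)) \<le> card (?M - ?B)"
    using finite_monomials[of "{..n}" k] by (intro card_mono) auto
  moreover have "card (?M - ?B) = card ?M - card ?B" "card ?B \<le> card ?M"
    using BM(1) finite_monomials[of "{..n}" k] by (auto intro: card_Diff_subset card_mono finite_subset)
  ultimately show ?thesis
    by linarith
qed

lemma box_without_last_empty:
  assumes "socle_degree < k"
  shows "box_without_last k = {}"
proof -
  have False if "m \<in> box_without_last k" for m
  proof -
    have m: "keys m \<subseteq> {..<n}" "mon_degree m = k" "\<And>i. i < n \<Longrightarrow> lookup m i < e i"
      using that by (auto simp: box_without_last_def monomials_def)
    have "k = (\<Sum>i<n. lookup m i)"
      using mon_degree_eq_sum[OF _ m(1)] m(2) by simp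
    also have "\<dots> \<le> socle_degree"
      unfolding socle_degree_def
    proof (rule sum_mono)
      fix i assume "i \<in> {..<n}"
      then show "lookup m i \<le> e i - 1"
        using m(3)[of i] by simp
    qed
    finally show False
      using assms by simp
  qed
  then show ?thesis
    by blast
qed

lemma standard_monomials_empty:
  assumes "socle_degree < k"
  shows "standard_monomials n (partial_ideal n) k = {}"
proof -
  have "card (standard_monomials n (partial_ideal n) k) = 0"
    using card_standard_monomials_le[of k] box_without_last_empty[OF assms] by simp
  moreover have "finite (standard_monomials n (partial_ideal n) k)"
    by (rule finite_subset[OF standard_monomials_subset finite_monomials[OF finite_lessThan]])
  ultimately show ?thesis
    by simp
qed

text \<open>
  The reflection \<open>m\<^sub>i \<mapsto> e\<^sub>i - 1 - m\<^sub>i\<close> of the box, which makes the Hilbert function of a complete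
  intersection symmetric. The exponent of the last variable is chosen to attain degree \<open>d + s\<close>; the
  inequality says that the other exponents add up to at least \<open>socle_degree - s\<close>.
\<close>

lemma card_box_reflect:
  assumes "socle_degree \<le> d"
  shows "card (box n s) \<le> card {m \<in> box n (d + s). d + socle_degree + lookup m n \<le> 2 * (d + s)}"
proof (rule card_inj_on_le)
  define r where "r m = single n (d - socle_degree + s + (s - lookup m n)) + (\<Sum>i<n. single i (e i - 1 - lookup m i))"
    for m :: mon
  have r_n: "lookup (r m) n = d - socle_degree + s + (s - lookup m n)" for m
    by (auto simp: r_def lookup_add lookup_sum lookup_single when_def)
  have r_i: "lookup (r m) i = e i - 1 - lookup m i" if "i < n" for i m
  proof -
    have "(\<Sum>j<n. lookup (single j (e j - 1 - lookup m j)) i) =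
        (\<Sum>j<n. if j = i then e i - 1 - lookup m i else 0)"
      by (intro sum.cong) (auto simp: lookup_single when_def)
    then show ?thesis
      using that by (simp add: r_def lookup_add lookup_sum lookup_single)
  qed
  have r_keys: "keys (r m) \<subseteq> {..n}" for m
  proof
    fix j assume "j \<in> keys (r m)"
    show "j \<in> {..n}"
    proof (rule ccontr)
      assume "j \<notin> {..n}"
      then have "lookup (r m) j = 0"
        by (auto simp: r_def lookup_add lookup_sum lookup_single when_def)
      with \<open>j \<in> keys (r m)\<close> show False
        by (simp add: in_keys_iff)
    qed
  qed
  have boxD: "keys m \<subseteq> {..n}" "\<And>i. i < n \<Longrightarrow> lookup m i < e i"
    "lookup m n + (\<Sum>i<n. lookup m i) = s" if "m \<in> box n s" for m
    using that mon_degree_last[of m n] by (auto simp: box_def monomials_def)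
  show "inj_on r (box n s)"
  proof (rule inj_onI)
    fix m m' assume m: "m \<in> box n s" and m': "m' \<in> box n s" and eq: "r m = r m'"
    have lt: "lookup m i = lookup m' i" if "i < n" for i
    proof -
      have "e i - 1 - lookup m i = e i - 1 - lookup m' i"
        using r_i[OF that, of m] r_i[OF that, of m'] eq by simp
      then show ?thesis
        using boxD(2)[OF m that] boxD(2)[OF m' that] by linarith
    qed
    then have "(\<Sum>i<n. lookup m i) = (\<Sum>i<n. lookup m' i)"
      by (intro sum.cong) auto
    then have "lookup m n = lookup m' n"
      using boxD(3)[OF m] boxD(3)[OF m'] by simp
    then show "m = m'"
      using lt by (subst mon_decompose[OF boxD(1)[OF m]], subst mon_decompose[OF boxD(1)[OF m']]) simp
  qed
  show "r ` box n s \<subseteq> {m \<in> box n (d + s). d + socle_degree + lookup m n \<le> 2 * (d + s)}"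
  proof (rule image_subsetI)
    fix m assume m: "m \<in> box n s"
    have "(\<Sum>i<n. lookup (r m) i) + (\<Sum>i<n. lookup m i) = socle_degree"
      unfolding sum.distrib[symmetric] socle_degree_def
    proof (rule sum.cong)
      fix i assume "i \<in> {..<n}"
      then show "lookup (r m) i + lookup m i = e i - 1"
        using boxD(2)[OF m, of i] r_i[of i m] by simp
    qed simp
    then have "lookup (r m) n + (\<Sum>i<n. lookup (r m) i) = d + s"
      using boxD(3)[OF m] r_n[of m] assms by linarith
    then have "mon_degree (r m) = d + s"
      using mon_degree_last[OF r_keys] by simp
    moreover have "lookup (r m) i < e i" if "i < n" for i
      using r_i[OF that, of m] e_pos[of i] that by simp
    ultimately have "r m \<in> box n (d + s)"
      using r_keys by (simp add: box_def monomials_def)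
    moreover have "d + socle_degree + lookup (r m) n \<le> 2 * (d + s)"
      using r_n[of m] assms boxD(3)[OF m] by simp
    ultimately show "r m \<in> {m \<in> box n (d + s). d + socle_degree + lookup m n \<le> 2 * (d + s)}"
      by simp
  qed
  show "finite {m \<in> box n (d + s). d + socle_degree + lookup m n \<le> 2 * (d + s)}"
    using finite_box by simp
qed

lemma card_non_lead_mons:
  "card (monomials {..n} k - lead_mons k (partial_ideal n)) = card (box n k)"
proof -
  have "card (monomials {..n} k - lead_mons k (partial_ideal n)) =
      card (monomials {..n} k) - card (lead_mons k (partial_ideal n))"
    using lead_mons_partial_ideal_subset[of n k] finite_subset[OF _ finite_monomials]
    by (intro card_Diff_subset) auto
  then show ?thesis
    using card_lead_mons_partial_ideal[of n k] by simp
qed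

text \<open>
  The upper bound on the initial ideal of the full ideal. Each box monomial of degree \<open>k - e n\<close> can
  contribute one new leading monomial of degree \<open>k\<close>; reflection shows that the box monomials of
  degree \<open>k\<close> with a small exponent of the last variable are at least as numerous.
\<close>

lemma card_lead_mons_full_le:
  assumes "socle_degree \<le> e n"
  shows "card (lead_mons k (partial_ideal (Suc n))) +
    card {m \<in> box n k. 2 * k < e n + socle_degree + lookup m n} \<le> card (monomials {..n} k)"
proof -
  let ?X = "{m \<in> box n k. 2 * k < e n + socle_degree + lookup m n}"
  let ?Y = "{m \<in> box n k. e n + socle_degree + lookup m n \<le> 2 * k}"
  let ?new = "if e n \<le> k then card (box n (k - e n)) else 0"
  have "card (lead_mons k (partial_ideal (Suc n))) \<le> card (lead_mons k (partial_ideal n)) +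
      (if e n \<le> k then card (monomials {..n} (k - e n) - lead_mons (k - e n) (partial_ideal n)) else 0)"
    unfolding partial_ideal_Suc unfolding partial_ideal_def using generators[of n]
    by (intro card_lead_mons_insert_le hs_in_poly_ring homogeneous_hs) auto
  then have "card (lead_mons k (partial_ideal (Suc n))) \<le> card (lead_mons k (partial_ideal n)) + ?new"
    by (simp only: card_non_lead_mons)
  moreover have "?new \<le> card ?Y"
    using card_box_reflect[OF assms, of "k - e n"] by (cases "e n \<le> k") simp_all
  moreover have "card ?X + card ?Y = card (?X \<union> ?Y)"
    using finite_box by (intro card_Un_disjoint[symmetric]) auto
  moreover have "?X \<union> ?Y = box n k"
    by auto
  ultimately show ?thesis
    using card_lead_mons_partial_ideal[of n k] by simp
qed

text \<open>
  The standard monomials \<open>z ^ (k - j) * b\<close> of the ideal of the first \<open>n\<close> generators that are not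
  multiples of the proposed new generators are those with \<open>j + k < e n + socle_degree\<close>.
\<close>

lemma card_remaining_monomials_le:
  defines "S k \<equiv> {j. j \<le> k \<and> j + k < e n + socle_degree}"
  shows "card (\<Union>j\<in>S k. (+) (single n (k - j)) ` standard_monomials n (partial_ideal n) j) \<le>
    card {m \<in> box n k. 2 * k < e n + socle_degree + lookup m n}"
proof -
  let ?B = "standard_monomials n (partial_ideal n)"
  have finS: "finite (S k)"
    by (simp add: S_def)
  have finB: "finite (?B j)" for j
    using finite_subset[OF standard_monomials_subset finite_monomials] by simp
  have "card (\<Union>j\<in>S k. (+) (single n (k - j)) ` ?B j) \<le> (\<Sum>j\<in>S k. card ((+) (single n (k - j)) ` ?B j))"
    by (rule card_UN_le[OF finS])
  also have "\<dots> \<le> (\<Sum>j\<in>S k. card (box_without_last j))"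
    using card_image_le[OF finB] card_standard_monomials_le by (intro sum_mono) (rule order_trans)
  also have "\<dots> = card (SIGMA j:S k. box_without_last j)"
    using finS finite_box_without_last by (simp add: card_SigmaI)
  also have "\<dots> \<le> card {m \<in> box n k. 2 * k < e n + socle_degree + lookup m n}"
  proof (rule card_inj_on_le)
    let ?f = "\<lambda>(j, b). single n (k - j) + b :: mon"
    have b: "keys b \<subseteq> {..n}" "lookup b n = 0" "mon_degree b = j" "\<forall>i<n. lookup b i < e i"
      if "b \<in> box_without_last j" for b j
    proof -
      show "keys b \<subseteq> {..n}" "mon_degree b = j" "\<forall>i<n. lookup b i < e i"
        using that by (auto simp: box_without_last_def monomials_def)
      have "n \<notin> keys b"
        using that by (auto simp: box_without_last_def monomials_def)
      then show "lookup b n = 0"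
        by (simp add: in_keys_iff)
    qed
    show "inj_on ?f (SIGMA j:S k. box_without_last j)"
    proof (rule inj_onI, clarsimp)
      fix j b j' b'
      assume *: "j \<in> S k" "b \<in> box_without_last j" "j' \<in> S k" "b' \<in> box_without_last j'"
        "single n (k - j) + b = single n (k - j') + b'"
      have "k - j = k - j'"
        using arg_cong[OF *(5), of "\<lambda>m. lookup m n"] b(2)[OF *(2)] b(2)[OF *(4)]
        by (simp add: lookup_add)
      then show "j = j' \<and> b = b'"
        using * by (auto simp: S_def)
    qed
    show "?f ` (SIGMA j:S k. box_without_last j) \<subseteq> {m \<in> box n k. 2 * k < e n + socle_degree + lookup m n}"
    proof (rule image_subsetI, clarify)
      fix j b assume j: "j \<in> S k" and bj: "b \<in> box_without_last j"
      have "single n (k - j) + b \<in> box n k"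
        using j b[OF bj] by (auto simp: box_def monomials_def keys_add_mon mon_degree_add
            lookup_add lookup_single when_def S_def split: if_splits)
      moreover have "2 * k < e n + socle_degree + lookup (single n (k - j) + b) n"
        using j b(2)[OF bj] by (auto simp: S_def lookup_add)
      ultimately show "single n (k - j) + b \<in> box n k \<and> 2 * k < e n + socle_degree + lookup (single n (k - j) + b) n"
        by blast
    qed
    show "finite {m \<in> box n k. 2 * k < e n + socle_degree + lookup m n}"
      using finite_box by simp
  qed
  finally show ?thesis .
qed


text \<open>
  Transfer from the Lucas polynomials, with a power of the last variable adjoined. This power does
  not affect the leading monomials with a smaller exponent of the last variable.
\<close>

lemma lead_mons_full_ideal:
  assumes d: "socle_degree \<le> e n" and s: "s \<le> socle_degree"
    and m: "m \<in> monomials {..n} (e n + s)" "lookup m n \<le> e n + 2 * s - socle_degree"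
  shows "m \<in> lead_mons (e n + s) (partial_ideal (Suc n))"
proof -
  let ?c = "e n + 2 * s - socle_degree + 1"
  let ?z = "mono_poly (single n ?c) :: (nat, 'k) mpoly"
  define g where "g = (mono_poly (single n (e n - socle_degree)) * (\<Prod>i<n. lucas_poly n i (e i)) :: (nat, 'k) mpoly)"
  define h where "h i = (if i = n then g else lucas_poly n i (Suc (e i)))" for i
  have h_image: "h ` {..<Suc n} \<union> mono_poly ` {single n ?c} =
      insert ?z (insert g ((\<lambda>i. lucas_poly n i (Suc (e i))) ` {..<n}))"
    by (auto simp: h_def lessThan_Suc)
  note lucas = lucas_ideal_contains_monomials[of n e "e n" s, where 'a = 'k, folded socle_degree_def, folded g_def]
  have "mono_poly ` monomials {..n} (e n + s) \<subseteq>
      ideal_gen {..n} ((!) hs ` {..<Suc n} \<union> mono_poly ` {single n ?c})"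
  proof (rule generic_spanning)
    show "mono_poly ` monomials {..n} (e n + s) \<subseteq>
        ideal_gen {..n} (h ` {..<Suc n} \<union> mono_poly ` {single n ?c})"
      unfolding h_image using lucas(3) e_pos d s by simp
    show "h i \<in> poly_ring {..n}" if "i < Suc n" for i
    proof -
      have "h i \<in> h ` {..<Suc n} \<union> mono_poly ` {single n ?c}"
        using that by blast
      then show ?thesis
        unfolding h_image using lucas(1) e_pos d s by auto
    qed
    show "homogeneous_of_degree (e i) (h i)" if "i < Suc n" for i
      using lucas(2) e_pos d s homogeneous_lucas_poly[of "e i" i n] by (auto simp: h_def)
  qed (auto split: if_splits)
  then have "mono_poly m \<in> graded_part (e n + s) (ideal_gen {..n} (insert ?z ((!) hs ` {..<Suc n})))"
    using m(1) by (auto simp: graded_part_def monomials_def homogeneous_mono_poly)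
  then show ?thesis
    unfolding partial_ideal_def using m(2) generators[of "Suc n"]
    by (intro lead_mon_without_last_power[OF _ _ _ lead_mon_mono_poly]) auto
qed

text \<open>
  The right hand side is contained in the initial ideal by the leading monomials found above. In the
  other direction it contains, in each degree, at least as many monomials as there are leading
  monomials.
\<close>

theorem initial_ideal_full:
  assumes d: "socle_degree \<le> e n"
  defines "Z \<equiv> \<Union>i\<in>{..socle_degree}. {mono_poly (single n (e n - socle_degree + 2 * i) + m) | m.
      m \<in> standard_monomials n (partial_ideal n) (socle_degree - i)} :: (nat, 'k) mpoly set"
  shows "initial_ideal {..n} (partial_ideal (Suc n)) = ideal_gen {..n} (initial_ideal {..n} (partial_ideal n) \<union> Z)"
proof -
  let ?B = "standard_monomials n (partial_ideal n)" and ?in = "initial_ideal {..n}"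
  let ?R = "ideal_gen {..n} (?in (partial_ideal n) \<union> Z)"
  note J = is_ideal_initial_ideal[OF is_ideal_partial_ideal[of "Suc n", OF order_refl]]
  have I': "is_ideal {..n} (?in (partial_ideal n))"
    by (intro is_ideal_initial_ideal is_ideal_partial_ideal) simp
  have Z_lead: "Z \<subseteq> ?in (partial_ideal (Suc n))"
  proof
    fix p assume "p \<in> Z"
    then obtain i b where i: "i \<le> socle_degree" and b: "b \<in> ?B (socle_degree - i)"
      and p: "p = mono_poly (single n (e n - socle_degree + 2 * i) + b)"
      by (auto simp: Z_def)
    let ?m = "single n (e n - socle_degree + 2 * i) + b"
    have b': "keys b \<subseteq> {..<n}" "mon_degree b = socle_degree - i"
      using b by (auto simp: standard_monomials_def monomials_def)
    then have "n \<notin> keys b"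
      by auto
    then have "lookup ?m n \<le> e n + 2 * i - socle_degree"
      using d by (simp add: lookup_add in_keys_iff)
    moreover have "?m \<in> monomials {..n} (e n + i)"
      using b' d i by (auto simp: monomials_def mon_degree_add keys_add_mon split: if_splits)
    ultimately have "?m \<in> lead_mons (e n + i) (partial_ideal (Suc n))"
      using d i by (intro lead_mons_full_ideal)
    then show "p \<in> ?in (partial_ideal (Suc n))"
      unfolding p using mono_poly_in_initial_ideal_partial_iff[of "Suc n" ?m] by (auto simp: lead_mons_def)
  qed
  have in_mono: "?in (partial_ideal n) \<subseteq> ?in (partial_ideal (Suc n))"
    unfolding initial_ideal_eq using partial_ideal_mono[of n "Suc n"] by (intro ideal_gen_mono) auto
  have RJ: "?R \<subseteq> ?in (partial_ideal (Suc n))"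
    using Z_lead in_mono J by (intro ideal_gen_minimal) auto
  have R: "is_ideal {..n} ?R"
    using Z_lead is_ideal_subset[OF J] in_mono by (intro is_ideal_ideal_gen) auto
  have RZ: "p \<in> ?R" if "p \<in> ?in (partial_ideal n) \<union> Z" for p
    using that ideal_gen_superset by blast
  have lead_in_R: "mono_poly m \<in> ?R" if m: "m \<in> lead_mons k (partial_ideal (Suc n))" for m k
  proof -
    let ?M = "monomials {..n} k"
    define Rk where "Rk = {m \<in> ?M. mono_poly m \<in> ?R}"
    have finM: "finite ?M"
      by (simp add: finite_monomials)
    have "Rk \<subseteq> lead_mons k (partial_ideal (Suc n))"
      using RJ mono_poly_in_initial_ideal_partial_iff[of "Suc n"] by (auto simp: Rk_def monomials_def)
    moreover have "card (lead_mons k (partial_ideal (Suc n))) \<le> card Rk"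
    proof -
      define S where "S = {j. j \<le> k \<and> j + k < e n + socle_degree}"
      (* A monomial outside of the right hand side is a standard monomial times a power of the last
         variable, and the power is too small for a multiple of a new generator. *)
      have rest: "?M - Rk \<subseteq> (\<Union>j\<in>S. (+) (single n (k - j)) ` ?B j)"
      proof
        fix m assume m: "m \<in> ?M - Rk"
        then have mk: "keys m \<subseteq> {..n}" "mon_degree m = k" and mR: "mono_poly m \<notin> ?R"
          by (auto simp: Rk_def monomials_def)
        define b where "b = (\<Sum>i<n. single i (lookup m i))"
        define j where "j = mon_degree b"
        have mb: "m = single n (lookup m n) + b"
          unfolding b_def by (rule mon_decompose[OF mk(1)])
        have b_le: "lookup b i \<le> lookup m i" for i
        proof -
          have "lookup m i = lookup (single n (lookup m n) + b) i"
            using mb by (rule arg_cong)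
          then show ?thesis
            unfolding lookup_add by linarith
        qed
        have b_n: "lookup b n = 0"
          by (auto simp: b_def lookup_sum lookup_single when_def)
        have deg: "lookup m n + j = k"
          using arg_cong[OF mb, of mon_degree] mk(2) by (simp add: mon_degree_add j_def)
        have "keys b \<subseteq> {..<n}"
        proof
          fix l assume "l \<in> keys b"
          then show "l \<in> {..<n}"
            by (auto simp: b_def in_keys_iff lookup_sum lookup_single when_def split: if_splits)
        qed
        moreover have "mono_poly b \<notin> ?in (partial_ideal n)"
        proof
          assume "mono_poly b \<in> ?in (partial_ideal n)"
          then have "mono_poly m \<in> ?in (partial_ideal n)"
            using mk(1) by (rule mono_poly_in_idealI[OF I']) (rule b_le)
          then show False
            using mR RZ by blast
        qed
        ultimately have bB: "b \<in> ?B j"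
          by (simp add: standard_monomials_def monomials_def j_def)
        then have j_le: "j \<le> socle_degree"
          using standard_monomials_empty[of j] by (cases "j \<le> socle_degree") auto
        have "j + k < e n + socle_degree"
        proof (rule ccontr)
          assume "\<not> j + k < e n + socle_degree"
          then have le: "e n - socle_degree + 2 * (socle_degree - j) \<le> lookup m n"
            using deg j_le d by simp
          have "mono_poly (single n (e n - socle_degree + 2 * (socle_degree - j)) + b) \<in> Z"
            unfolding Z_def using bB j_le by (intro UN_I[of "socle_degree - j"] CollectI exI[of _ b]) auto
          then have "mono_poly (single n (e n - socle_degree + 2 * (socle_degree - j)) + b) \<in> ?R"
            using RZ by blast
          moreover have "lookup (single n (e n - socle_degree + 2 * (socle_degree - j)) + b) i \<le> lookup m i" for i
            using le b_n b_le[of i] by (cases "n = i") (auto simp: lookup_add lookup_single)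
          ultimately have "mono_poly m \<in> ?R"
            using mono_poly_in_idealI[OF R _ mk(1)] by blast
          with mR show False
            by blast
        qed
        then have "j \<in> S" and mj: "lookup m n = k - j"
          using deg by (auto simp: S_def)
        have "m = single n (k - j) + b"
          using mb unfolding mj .
        then show "m \<in> (\<Union>j\<in>S. (+) (single n (k - j)) ` ?B j)"
          using bB by (intro UN_I[of j] image_eqI[of _ _ b] \<open>j \<in> S\<close>)
      qed
      have "finite (\<Union>j\<in>S. (+) (single n (k - j)) ` ?B j)"
        using finite_subset[OF standard_monomials_subset finite_monomials] by (auto simp: S_def)
      then have "card (?M - Rk) \<le> card (\<Union>j\<in>S. (+) (single n (k - j)) ` ?B j)"
        using rest by (rule card_mono)
      also have "\<dots> \<le> card {m \<in> box n k. 2 * k < e n + socle_degree + lookup m n}"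
        unfolding S_def by (rule card_remaining_monomials_le)
      finally have "card (?M - Rk) \<le> card {m \<in> box n k. 2 * k < e n + socle_degree + lookup m n}" .
      moreover note card_lead_mons_full_le[OF d, of k]
      moreover have "card (?M - Rk) = card ?M - card Rk" "card Rk \<le> card ?M"
        using finM by (auto simp: Rk_def intro!: card_Diff_subset card_mono)
      ultimately show ?thesis
        by linarith
    qed
    ultimately have "Rk = lead_mons k (partial_ideal (Suc n))"
      using finite_lead_mons[OF _ is_ideal_subset[OF is_ideal_partial_ideal]] by (intro card_seteq) auto
    then show ?thesis
      using m by (auto simp: Rk_def)
  qed
  have "?in (partial_ideal (Suc n)) \<subseteq> ?R"
    unfolding initial_ideal_eq[of _ "partial_ideal (Suc n)"]
  proof (rule ideal_gen_minimal[OF _ R])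
    show "mono_poly ` {m. \<exists>p\<in>partial_ideal (Suc n). is_lead_mon p m} \<subseteq> ?R"
      using lead_in_R by (auto simp: lead_mons_def)
  qed
  with RJ show ?thesis
    by blast
qed

end

theorem proposition3p12:
  fixes F :: "'k::field set"
    and n d \<delta> :: nat
    and ds :: "nat list"
    and fs :: "(nat, 'k) mpoly list"
    and g :: "(nat, 'k) mpoly"
    and I :: "(nat, 'k) mpoly set"
    and B :: "nat \<Rightarrow> mon set"
  assumes "infinite (UNIV :: 'k set)"
    and "is_subfield F"
    and "length ds = n"
    and "generic_generators F {..n} (ds @ [d]) (fs @ [g])"
    and "I = ideal_gen {..n} (set fs)"
    and "\<delta> = sum_list ds - n"
    and "\<And>k. B k = standard_monomials n I k"
    and "d \<ge> \<delta>"
  shows "initial_ideal {..n} (ideal_gen {..n} (set fs \<union> {g})) =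
    ideal_gen {..n} (initial_ideal {..n} I \<union>
      (\<Union>i\<in>{..\<delta>}. {mono_poly (Poly_Mapping.single n (d - \<delta> + 2 * i) + m) | m. m \<in> B (\<delta> - i)}))"
proof -
  let ?e = "\<lambda>i. (ds @ [d]) ! i"
  interpret generic_ideal F n ?e "ds @ [d]" "fs @ [g]"
    by unfold_locales (use assms in simp_all)
  have len: "length fs = n"
    using length_hs by simp
  have gens: "(!) (fs @ [g]) ` {..<n} = set fs"
    using len by (auto simp: nth_append in_set_conv_nth image_iff)
  have g_last: "(fs @ [g]) ! n = g"
    using len by (simp add: nth_append)
  have gens': "(!) (fs @ [g]) ` {..<Suc n} = set fs \<union> {g}"
    using gens g_last by (simp add: lessThan_Suc)
  have ds_ge: "1 \<le> ds ! i" if "i < n" for i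
    using e_pos[of i] that assms(3) by (simp add: nth_append)
  have "(\<Sum>i<n. ds ! i) = (\<Sum>i<n. (ds ! i - 1) + 1)"
  proof (intro sum.cong refl)
    fix i assume "i \<in> {..<n}"
    then show "ds ! i = (ds ! i - 1) + 1"
      using ds_ge[of i] by simp
  qed
  also have "\<dots> = (\<Sum>i<n. ds ! i - 1) + n"
    by (subst sum.distrib) simp
  finally have "sum_list ds = (\<Sum>i<n. ds ! i - 1) + n"
    using assms(3) by (simp add: sum_list_sum_nth atLeast0LessThan)
  moreover have "generic_ideal.socle_degree n (ds @ [d]) = (\<Sum>i<n. ds ! i - 1)"
    using assms(3) unfolding socle_degree_def by (intro sum.cong) (auto simp: nth_append)
  ultimately have \<delta>: "generic_ideal.socle_degree n (ds @ [d]) = \<delta>"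
    using assms(6) by simp
  have d_last: "(ds @ [d]) ! n = d"
    using assms(3) by (simp add: nth_append)
  have "generic_ideal.socle_degree n (ds @ [d]) \<le> (ds @ [d]) ! n"
    using \<delta> d_last assms(8) by simp
  from initial_ideal_full[OF this] show ?thesis
    unfolding partial_ideal_def gens gens' \<delta> d_last assms(5,7) .
qed

end
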